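(* Let $\Pi$ be an $\mathsf{LCL}$ problem having no certificate for $O(\log n)$ solvability. Then both the randomized and the deterministic complexity of $\Pi$ in the $\mathsf{LOCAL}$ model (on $n$-node full $\delta$-ary rooted trees) are $\Omega(n^{1/k})$ for some integer $k\ge 1$.
   Context: An $\mathsf{LCL}$ problem is a triple $\Pi=(\delta,\Sigma,\mathcal C)$ where $\delta\ge 1$ is an integer, $\Sigma$ is a finite set of labels, and $\mathcal C\subseteq\Sigma^{\delta+1}$ is a set of allowed configurations, written $(a:b_1,\dots,b_\delta)$; the order of $b_1,\dots,b_\delta$ is irrelevant. Inputs are unlabeled full $\delta$-ary rooted trees (every node has exactly $\delta$ or $0$ children). A solution on a tree $T$ is a labeling $\lambda:V(T)\to\Sigma$ such that for every node $v$ with $\delta$ children $v_1,\dots,v_\delta$ there is a permutation $\rho$ of $\{1,\dots,\delta\}$ with $(\lambda(v):\lambda(v_{\rho(1)}),\dots,\lambda(v_{\rho(\delta)}))\in\mathcal C$; nodes whose number of children is not $\delta$ are unconstrained. The restriction of $\Pi$ to $\Sigma'\subseteq\Sigma$ is $(\delta,\Sigma',\mathcal C')$ where $\mathcal C'$ consists of all configurations of $\mathcal C$ using only labels in $\Sigma'$. The automaton $\mathcal M(\Pi)$ is the directed graph with vertex set $\Sigma$ and an edge $a\to b$ whenever some $(a:b_1,\dots,b_\delta)\in\mathcal C$ has $b=b_i$ for some $i$. A label $a$ is path-flexible in $\Pi$ if there is $K$ such that for all $k\ge K$ there is a walk from $a$ to $a$ of length exactly $k$ in $\mathcal M(\Pi)$;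 otherwise it is path-inflexible. Certificate for $O(\log n)$ solvability: let $\Pi_0=\Pi$ and let $\Pi_{i+1}$ be the restriction of $\Pi_i$ to the labels that are path-flexible in $\Pi_i$; iterate until a fixed point $\Pi_i=\Pi_{i-1}$ is reached. $\Pi$ has a certificate for $O(\log n)$ solvability iff the label set of the fixed point is nonempty. Model. In $\mathsf{LOCAL}$ on an $n$-node graph each node has a unique identifier from $\{1,\dots,\mathrm{poly}(n)\}$ and initially knows its identifier, its degree, $n$, the maximum degree, and which incident edge leads to its parent. In synchronous rounds nodes exchange unbounded messages with neighbors and do unbounded local computation; each node eventually outputs its label. The running time is the number of rounds until all nodes have output. In the randomized version each node has its own stream of random bits and the global output must be correct with probability at least $1-1/n$. The complexity of $\Pi$ is the best worst-case running time, as a function of $n$, of an algorithm solving $\Pi$. *)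

theory Defs
  imports "HOL-Probability.Probability"
begin

section \<open>LCL problems and the certificate for O(log n) solvability\<close>

text \<open>A configuration \<open>(a : b\<^sub>1, \<dots>, b\<^sub>\<delta>)\<close> is the pair of \<open>a\<close> and the list
  \<open>[b\<^sub>1, \<dots>, b\<^sub>\<delta>]\<close>. That the order of the list is irrelevant is accounted for by the
  permutation in \<open>is_solution\<close> below.\<close>

record 'l lcl =
  arity :: nat
  labels :: "'l set"
  configs :: "('l \<times> 'l list) set"

definition lcl_problem :: "'l lcl \<Rightarrow> bool" where
  "lcl_problem P \<longleftrightarrow> arity P \<ge> 1 \<and> finite (labels P) \<and>
     (\<forall>(a, bs) \<in> configs P. a \<in> labels P \<and> set bs \<subseteq> labels P \<and> length bs = arity P)"

definition restriction :: "'l lcl \<Rightarrow> 'l set \<Rightarrow> 'l lcl" where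
  "restriction P L =
     \<lparr>arity = arity P, labels = L,
      configs = {(a, bs) \<in> configs P. a \<in> L \<and> set bs \<subseteq> L}\<rparr>"

definition automaton :: "'l lcl \<Rightarrow> ('l \<times> 'l) set" where
  "automaton P = {(a, b). \<exists>bs. (a, bs) \<in> configs P \<and> b \<in> set bs}"

definition path_flexible :: "'l lcl \<Rightarrow> 'l \<Rightarrow> bool" where
  "path_flexible P a \<longleftrightarrow> (\<exists>K. \<forall>k\<ge>K. (a, a) \<in> automaton P ^^ k)"

fun flexible_restriction :: "'l lcl \<Rightarrow> nat \<Rightarrow> 'l lcl" where
  "flexible_restriction P 0 = P"
| "flexible_restriction P (Suc i) =
     (let P' = flexible_restriction P i
      in restriction P' {a \<in> labels P'. path_flexible P' a})"

definition has_log_certificate :: "'l lcl \<Rightarrow> bool" where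
  "has_log_certificate P \<longleftrightarrow>
     (\<exists>i\<ge>1. flexible_restriction P i = flexible_restriction P (i - 1) \<and>
            labels (flexible_restriction P i) \<noteq> {})"


section \<open>Full rooted trees and solutions\<close>

text \<open>A node is the list of child indices on the path from the root to it, so the root is
  \<open>[]\<close> and the children of \<open>v\<close> are \<open>v @ [0], v @ [1], \<dots>\<close>. The tree is the set of its nodes.
  The numbering of the children serves only as the port numbering that lets a node address
  its incident edges; as algorithms are judged on all trees, it is adversarial.\<close>

type_synonym node = "nat list"

definition full_tree :: "nat \<Rightarrow> node set \<Rightarrow> bool" where
  "full_tree \<delta> V \<longleftrightarrow> finite V \<and> [] \<in> V \<and> (\<forall>v i. v @ [i] \<in> V \<longrightarrow> v \<in> V) \<and>
     (\<forall>v\<in>V. {i. v @ [i] \<in> V} = {..<\<delta>} \<or> {i. v @ [i] \<in> V} = {})"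

definition tree_sizes :: "nat \<Rightarrow> nat set" where
  "tree_sizes \<delta> = card ` {V. full_tree \<delta> V}"

definition is_solution :: "'l lcl \<Rightarrow> node set \<Rightarrow> (node \<Rightarrow> 'l) \<Rightarrow> bool" where
  "is_solution P V lab \<longleftrightarrow> lab ` V \<subseteq> labels P \<and>
     (\<forall>v\<in>V. {i. v @ [i] \<in> V} = {..<arity P} \<longrightarrow>
        (\<exists>\<rho>. \<rho> permutes {..<arity P} \<and>
           (lab v, map (\<lambda>i. lab (v @ [\<rho> i])) [0..<arity P]) \<in> configs P))"


section \<open>The LOCAL model\<close>

text \<open>The port \<open>Parent\<close> is the edge to the parent, so that every node knows which of its
  incident edges leads there.\<close>

datatype port = Parent | Child nat

fun peer :: "node set \<Rightarrow> node \<Rightarrow> port \<Rightarrow> (node \<times> port) option" where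
  "peer V v Parent = (if v = [] then None else Some (butlast v, Child (last v)))"
| "peer V v (Child i) = (if v @ [i] \<in> V then Some (v @ [i], Parent) else None)"

definition node_degree :: "node set \<Rightarrow> node \<Rightarrow> nat" where
  "node_degree V v = card {q. peer V v q \<noteq> None}"

record local_input =
  unique_id :: nat
  degree_of_node :: nat
  number_of_nodes :: nat
  maximum_degree :: nat
  has_parent :: bool

text \<open>States and messages are infinite bit sequences. This is no restriction: all that a node
  can learn in finitely many rounds consists of finitely many numbers and random bit streams,
  which can be encoded in one such sequence. The maps of an algorithm are arbitrary functions.

  The type \<open>'r\<close> is that of the private randomness of a node: \<open>unit\<close> for deterministic
  algorithms, \<open>bool stream\<close> for randomized ones. A node has no output as long as \<open>alg_output\<close>
  is \<open>None\<close> on its state. In \<open>alg_receive\<close>, the argument is \<open>None\<close> at ports without an edge.\<close>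

type_synonym data = "nat \<Rightarrow> bool"

record ('r, 'l) local_algorithm =
  alg_init :: "local_input \<Rightarrow> 'r \<Rightarrow> data"
  alg_send :: "data \<Rightarrow> port \<Rightarrow> data"
  alg_receive :: "data \<Rightarrow> (port \<Rightarrow> data option) \<Rightarrow> data"
  alg_output :: "data \<Rightarrow> 'l option"

definition input_of :: "node set \<Rightarrow> (node \<Rightarrow> nat) \<Rightarrow> node \<Rightarrow> local_input" where
  "input_of V ident v =
     \<lparr>unique_id = ident v, degree_of_node = node_degree V v, number_of_nodes = card V,
      maximum_degree = Max (node_degree V ` V), has_parent = (v \<noteq> [])\<rparr>"

primrec state_after ::
  "('r, 'l) local_algorithm \<Rightarrow> node set \<Rightarrow> (node \<Rightarrow> nat) \<Rightarrow> (node \<Rightarrow> 'r) \<Rightarrow> nat \<Rightarrow> node \<Rightarrow> data"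
where
  "state_after A V ident \<omega> 0 = (\<lambda>v. alg_init A (input_of V ident v) (\<omega> v))"
| "state_after A V ident \<omega> (Suc t) =
     (\<lambda>v. alg_receive A (state_after A V ident \<omega> t v)
        (\<lambda>q. map_option (\<lambda>(u, q'). alg_send A (state_after A V ident \<omega> t u) q') (peer V v q)))"

text \<open>An output is irrevocable: it is the first one that a node produces.\<close>

definition has_output_at ::
  "('r, 'l) local_algorithm \<Rightarrow> node set \<Rightarrow> (node \<Rightarrow> nat) \<Rightarrow> (node \<Rightarrow> 'r) \<Rightarrow> node \<Rightarrow> nat \<Rightarrow> bool"
where
  "has_output_at A V ident \<omega> v t \<longleftrightarrow> alg_output A (state_after A V ident \<omega> t v) \<noteq> None"

definition node_output ::
  "('r, 'l) local_algorithm \<Rightarrow> node set \<Rightarrow> (node \<Rightarrow> nat) \<Rightarrow> (node \<Rightarrow> 'r) \<Rightarrow> node \<Rightarrow> 'l option"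
where
  "node_output A V ident \<omega> v =
     (if \<exists>t. has_output_at A V ident \<omega> v t
      then alg_output A (state_after A V ident \<omega> (LEAST t. has_output_at A V ident \<omega> v t) v)
      else None)"

definition rounds ::
  "('r, 'l) local_algorithm \<Rightarrow> node set \<Rightarrow> (node \<Rightarrow> nat) \<Rightarrow> (node \<Rightarrow> 'r) \<Rightarrow> enat"
where
  "rounds A V ident \<omega> = (SUP v\<in>V. INF t\<in>{t. has_output_at A V ident \<omega> v t}. enat t)"

definition correct_output :: "'l lcl \<Rightarrow> node set \<Rightarrow> (node \<Rightarrow> 'l option) \<Rightarrow> bool" where
  "correct_output P V out \<longleftrightarrow>
     (\<exists>lab. (\<forall>v\<in>V. out v = Some (lab v)) \<and> is_solution P V lab)"

text \<open>Identifiers of \<open>n\<close>-node trees come from \<open>{1..p n}\<close>, where \<open>p\<close> is polynomially bounded;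
  \<open>n \<le> p n\<close> makes unique identifiers possible.\<close>

definition polynomial_id_range :: "(nat \<Rightarrow> nat) \<Rightarrow> bool" where
  "polynomial_id_range p \<longleftrightarrow>
     (\<forall>n. n \<le> p n) \<and> (\<exists>d::nat. (\<lambda>n. real (p n)) \<in> O(\<lambda>n. real n ^ d))"

definition instances :: "(nat \<Rightarrow> nat) \<Rightarrow> nat \<Rightarrow> (node set \<times> (node \<Rightarrow> nat)) set" where
  "instances p \<delta> =
     {(V, ident). full_tree \<delta> V \<and> inj_on ident V \<and> ident ` V \<subseteq> {1..p (card V)}}"

definition instances_of_size ::
  "(nat \<Rightarrow> nat) \<Rightarrow> nat \<Rightarrow> nat \<Rightarrow> (node set \<times> (node \<Rightarrow> nat)) set"
where
  "instances_of_size p \<delta> n = {(V, ident) \<in> instances p \<delta>. card V = n}"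


section \<open>Deterministic and randomized complexity\<close>

definition det_solves :: "(nat \<Rightarrow> nat) \<Rightarrow> 'l lcl \<Rightarrow> (unit, 'l) local_algorithm \<Rightarrow> bool" where
  "det_solves p P A \<longleftrightarrow>
     (\<forall>(V, ident) \<in> instances p (arity P).
        correct_output P V (node_output A V ident (\<lambda>_. ())))"

definition det_time ::
  "(nat \<Rightarrow> nat) \<Rightarrow> 'l lcl \<Rightarrow> (unit, 'l) local_algorithm \<Rightarrow> nat \<Rightarrow> enat"
where
  "det_time p P A n =
     (SUP (V, ident) \<in> instances_of_size p (arity P) n. rounds A V ident (\<lambda>_. ()))"

text \<open>The infimum is \<open>\<infinity>\<close> if no algorithm solves the problem.\<close>

definition det_complexity :: "(nat \<Rightarrow> nat) \<Rightarrow> 'l lcl \<Rightarrow> nat \<Rightarrow> enat" where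
  "det_complexity p P n = (INF A \<in> {A. det_solves p P A}. det_time p P A n)"

definition random_bits :: "node set \<Rightarrow> (node \<Rightarrow> bool stream) measure" where
  "random_bits V = (\<Pi>\<^sub>M v\<in>V. stream_space (measure_pmf (bernoulli_pmf (1/2))))"

text \<open>The first condition says that the outputs are random variables; without it the success
  probability need not be defined.\<close>

definition rand_solves ::
  "(nat \<Rightarrow> nat) \<Rightarrow> 'l lcl \<Rightarrow> (bool stream, 'l) local_algorithm \<Rightarrow> bool"
where
  "rand_solves p P A \<longleftrightarrow>
     (\<forall>(V, ident) \<in> instances p (arity P).
        (\<forall>v\<in>V. (\<lambda>\<omega>. node_output A V ident \<omega> v)
                 \<in> measurable (random_bits V) (count_space UNIV)) \<and>
        measure (random_bits V)
          {\<omega> \<in> space (random_bits V). correct_output P V (node_output A V ident \<omega>)}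
          \<ge> 1 - 1 / real (card V))"

definition rand_time ::
  "(nat \<Rightarrow> nat) \<Rightarrow> 'l lcl \<Rightarrow> (bool stream, 'l) local_algorithm \<Rightarrow> nat \<Rightarrow> enat"
where
  "rand_time p P A n =
     (SUP (V, ident) \<in> instances_of_size p (arity P) n.
        SUP \<omega> \<in> space (random_bits V). rounds A V ident \<omega>)"

definition rand_complexity :: "(nat \<Rightarrow> nat) \<Rightarrow> 'l lcl \<Rightarrow> nat \<Rightarrow> enat" where
  "rand_complexity p P n = (INF A \<in> {A. rand_solves p P A}. rand_time p P A n)"

text \<open>The library's \<open>\<Omega>\<close> does not cover \<^typ>\<open>enat\<close>-valued functions. Only those \<open>n\<close> matter
  for which there are \<open>n\<close>-node full \<open>\<delta>\<close>-ary trees, that is, \<open>n \<equiv> 1\<close> modulo \<open>\<delta>\<close>; for other \<open>n\<close>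
  the worst-case running time is a supremum over the empty set.\<close>

definition complexity_Omega :: "nat \<Rightarrow> (nat \<Rightarrow> enat) \<Rightarrow> (nat \<Rightarrow> real) \<Rightarrow> bool" where
  "complexity_Omega \<delta> f g \<longleftrightarrow>
     (\<exists>c>0. \<forall>\<^sub>F n in sequentially.
        n \<in> tree_sizes \<delta> \<longrightarrow> ereal (c * g n) \<le> ereal_of_enat (f n))"

end

theory Submission
  imports Defs "HOL-Library.Sublist"
begin

text \<open>Deterministic algorithms are randomized ones that ignore their bits, so only the randomized
  bound matters. Let \<open>k\<close> be such that \<open>\<Sigma>\<^sub>k = {}\<close>, where \<open>\<Sigma>\<^sub>i\<close> is the label set of the \<open>i\<close>-th
  restriction \<open>\<Pi>\<^sub>i\<close>, and suppose that an algorithm runs for at most \<open>T\<close> rounds, where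
  \<open>(C (T + 1))\<^sup>k\<^sup>+\<^sup>2 \<le> n\<close>. One \<open>n\<close>-node tree, built from paths of length \<open>\<Theta>(T)\<close> nested to depth \<open>k\<close>, yields
  sets \<open>G\<^sub>0, \<dots>, G\<^sub>k\<close> of nodes such that, whatever the identifiers, a node of \<open>G\<^sub>i\<close> gets a label outside
  \<open>\<Sigma>\<^sub>i\<close> with probability at most \<open>(O(T))\<^sup>i / n\<close>. For \<open>i = k\<close> this probability is \<open>1\<close>, a contradiction.

  In the induction step, let \<open>v \<in> G\<^sub>i\<^sub>+\<^sub>1\<close>. There are nodes \<open>u\<close> and its child \<open>u'\<close> far above \<open>v\<close> and a node
  \<open>u''\<close> far below \<open>v\<close> whose \<open>T\<close>-neighbourhoods are isomorphic. Permuting identifiers and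
  random bits, so that \<open>v\<close> keeps its view and \<open>u'\<close> (or \<open>u''\<close>) gets the view of \<open>u\<close>, preserves the
  outputs \<open>a\<close> of \<open>v\<close> and \<open>b\<close> of \<open>u\<close>. Unless one of the three runs fails at a node of \<open>G\<^sub>i\<close> on or next to the
  path from \<open>u\<close> to \<open>u''\<close>, the automaton of \<open>\<Pi>\<^sub>i\<close> has walks from \<open>b\<close> to \<open>a\<close> of two consecutive lengths and a walk
  from \<open>a\<close> to \<open>b\<close>. Hence it has closed walks at \<open>a\<close> of consecutive lengths, and \<open>a\<close> is path-flexible in
  \<open>\<Pi>\<^sub>i\<close>. As permutations preserve the product measure, no independence is needed: a union bound over
  the \<open>O(T)\<close> nodes involved suffices.\<close>

section \<open>Flexible labels and walks along solutions\<close>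

text \<open>Loops of the coprime lengths \<open>c\<close> and \<open>c + 1\<close> combine to every
  large length: for \<open>k = q * c + r\<close> with \<open>r < c \<le> q\<close>, take
  \<open>q - r\<close> loops of length \<open>c\<close> and \<open>r\<close> loops of length
  \<open>c + 1\<close>.\<close>

lemma relpow_closed_consecutive:
  assumes c: "(a, a) \<in> R ^^ c" and Sc: "(a, a) \<in> R ^^ Suc c" and k: "c * c \<le> k"
  shows "(a, a) \<in> R ^^ k"
proof -
  have mult: "(a, a) \<in> R ^^ (m * q)" if "(a, a) \<in> R ^^ m" for m q :: nat
  proof (induction q)
    case (Suc q)
    then show ?case
      using that by (auto simp: relpow_add)
  qed auto
  show ?thesis
  proof (cases "c = 0")
    case True
    then show ?thesis
      using mult[OF Sc, of k] by simp
  next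
    case False
    define q r where "q = k div c" and "r = k mod c"
    have r: "r < c" and "c \<le> q"
      using False k by (auto simp: q_def r_def less_eq_div_iff_mult_less_eq)
    then have "r \<le> q"
      by linarith
    have "k = q * c + r"
      by (simp add: q_def r_def)
    also have "q * c = c * (q - r) + c * r"
      using \<open>r \<le> q\<close> by (metis add_mult_distrib2 le_add_diff_inverse2 mult.commute)
    finally have "k = c * (q - r) + Suc c * r"
      by simp
    moreover have "(a, a) \<in> R ^^ (c * (q - r) + Suc c * r)"
      unfolding relpow_add using mult[OF c] mult[OF Sc] by (rule relcompI)
    ultimately show ?thesis
      by simp
  qed
qed

lemma path_flexibleI:
  assumes "(a, a) \<in> automaton P ^^ c" "(a, a) \<in> automaton P ^^ Suc c"
  shows "path_flexible P a"
  unfolding path_flexible_def using relpow_closed_consecutive[OF assms] by blast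

lemma labels_flexible_restriction_Suc:
  "labels (flexible_restriction P (Suc i)) =
     {a \<in> labels (flexible_restriction P i). path_flexible (flexible_restriction P i) a}"
  by (simp add: Let_def restriction_def)

text \<open>As the label sets decrease, restricting repeatedly is the same as restricting once to
  the last label set. Hence the labels determine the restricted problem, and a fixed point of the
  label sets is a fixed point of the problems.\<close>

lemma configs_flexible_restriction:
  assumes "lcl_problem P"
  shows "configs (flexible_restriction P i) =
    {(a, bs) \<in> configs P. a \<in> labels (flexible_restriction P i) \<and>
       set bs \<subseteq> labels (flexible_restriction P i)}"
proof (induction i)
  case 0
  then show ?case
    using assms by (auto simp: lcl_problem_def)
next
  case (Suc i)
  show ?case
    unfolding labels_flexible_restriction_Suc
    by (simp add: Let_def restriction_def Suc) blast
qed

lemma arity_flexible_restriction: "arity (flexible_restriction P i) = arity P"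
  by (induction i) (auto simp: Let_def restriction_def)

text \<open>A decreasing chain of finite sets must become stationary, and without a certificate it
  can do so only at the empty set.\<close>

lemma flexible_restriction_labels_empty:
  assumes P: "lcl_problem P" and no: "\<not> has_log_certificate P"
  obtains k where "k \<ge> 1" "labels (flexible_restriction P k) = {}"
proof -
  let ?L = "\<lambda>i. labels (flexible_restriction P i)"
  have anti: "?L (Suc i) \<subseteq> ?L i" for i
    unfolding labels_flexible_restriction_Suc by blast
  have fin: "finite (?L i)" for i
    using P anti by (induction i) (auto simp: lcl_problem_def intro: finite_subset)
  have "\<exists>i. ?L (Suc i) = ?L i"
  proof (rule ccontr)
    assume "\<nexists>i. ?L (Suc i) = ?L i"
    then have "card (?L (Suc i)) < card (?L i)" for i
      using anti fin by (metis psubsetI psubset_card_mono)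
    then have "card (?L i) + i \<le> card (?L 0)" for i
    proof (induction i)
      case (Suc i)
      then show ?case
        using Suc.IH[OF Suc.prems] Suc.prems[of i] by linarith
    qed simp
    from this[of "Suc (card (?L 0))"] show False
      by simp
  qed
  then obtain i where i: "?L (Suc i) = ?L i"
    by blast
  have "flexible_restriction P (Suc i) = flexible_restriction P i"
  proof (rule lcl.equality)
    show "configs (flexible_restriction P (Suc i)) = configs (flexible_restriction P i)"
      using i by (simp only: configs_flexible_restriction[OF P])
    show "labels (flexible_restriction P (Suc i)) = labels (flexible_restriction P i)"
      by fact
    show "arity (flexible_restriction P (Suc i)) = arity (flexible_restriction P i)"
      by (simp only: arity_flexible_restriction)
  qed simp
  then have "?L (Suc i) = {}"
    using no unfolding has_log_certificate_def by (metis diff_Suc_1 le_add1 plus_1_eq_Suc)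
  then show ?thesis
    using that[of "Suc i"] by simp
qed

text \<open>An edge of the restricted automaton comes from a configuration lying entirely in the
  restricted label set. This is why the siblings of \<open>w @ [c]\<close> must have labels from it
  as well.\<close>

lemma solution_edge:
  assumes P: "lcl_problem P" and V: "full_tree (arity P) V" and sol: "is_solution P V lab"
    and e: "w @ [c] \<in> V"
    and w: "lab w \<in> labels (flexible_restriction P i)"
    and ch: "\<And>c. w @ [c] \<in> V \<Longrightarrow> lab (w @ [c]) \<in> labels (flexible_restriction P i)"
  shows "(lab w, lab (w @ [c])) \<in> automaton (flexible_restriction P i)"
proof -
  have "w \<in> V"
    using V e unfolding full_tree_def by blast
  moreover have children: "{i. w @ [i] \<in> V} = {..<arity P}"
    using V e \<open>w \<in> V\<close> unfolding full_tree_def by blast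
  ultimately obtain \<rho> where \<rho>: "\<rho> permutes {..<arity P}"
    and conf: "(lab w, map (\<lambda>i. lab (w @ [\<rho> i])) [0..<arity P]) \<in> configs P"
    using sol unfolding is_solution_def by blast
  let ?bs = "map (\<lambda>i. lab (w @ [\<rho> i])) [0..<arity P]"
  have "set ?bs \<subseteq> labels (flexible_restriction P i)"
  proof safe
    fix b assume "b \<in> set ?bs"
    then obtain j where "j < arity P" "b = lab (w @ [\<rho> j])"
      by auto
    moreover from this have "\<rho> j \<in> {..<arity P}"
      using permutes_in_image[OF \<rho>] by blast
    ultimately show "b \<in> labels (flexible_restriction P i)"
      using ch children by blast
  qed
  then have "(lab w, ?bs) \<in> configs (flexible_restriction P i)"
    unfolding configs_flexible_restriction[OF P] using conf w by blast
  moreover have "lab (w @ [c]) \<in> set ?bs"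
  proof -
    have "c \<in> {..<arity P}"
      using children e by blast
    \<comment> \<open>The child \<open>c\<close> occurs in the permuted configuration at position
      \<open>inv \<rho> c\<close>.\<close>
    then have "inv \<rho> c < arity P" "\<rho> (inv \<rho> c) = c"
      using permutes_in_image[OF permutes_inv[OF \<rho>]] permutes_inverses[OF \<rho>] by blast+
    then show ?thesis
      by (force simp: image_iff)
  qed
  ultimately show ?thesis
    unfolding automaton_def by blast
qed

lemma solution_walk:
  assumes P: "lcl_problem P" and V: "full_tree (arity P) V" and sol: "is_solution P V lab"
    and y: "x @ y \<in> V"
    and w: "\<And>w. prefix x w \<Longrightarrow> strict_prefix w (x @ y) \<Longrightarrow>
      lab w \<in> labels (flexible_restriction P i) \<and>
      (\<forall>c. w @ [c] \<in> V \<longrightarrow> lab (w @ [c]) \<in> labels (flexible_restriction P i))"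
  shows "(lab x, lab (x @ y)) \<in> automaton (flexible_restriction P i) ^^ length y"
  using y w
proof (induction y rule: rev_induct)
  case (snoc c y)
  have "x @ y \<in> V"
    using snoc.prems(1) V unfolding full_tree_def by (metis append.assoc)
  then have "(lab x, lab (x @ y)) \<in> automaton (flexible_restriction P i) ^^ length y"
  proof (rule snoc.IH)
    fix w assume "prefix x w" "strict_prefix w (x @ y)"
    moreover from this have "strict_prefix w (x @ y @ [c])"
      by (metis append.assoc prefix_order.dual_order.strict_trans strict_prefixI')
    ultimately show "lab w \<in> labels (flexible_restriction P i) \<and>
        (\<forall>c. w @ [c] \<in> V \<longrightarrow> lab (w @ [c]) \<in> labels (flexible_restriction P i))"
      using snoc.prems(2) by blast
  qed
  moreover have "(lab (x @ y), lab ((x @ y) @ [c])) \<in> automaton (flexible_restriction P i)"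
  proof (rule solution_edge[OF P V sol])
    have "lab (x @ y) \<in> labels (flexible_restriction P i) \<and>
        (\<forall>c. (x @ y) @ [c] \<in> V \<longrightarrow> lab ((x @ y) @ [c]) \<in> labels (flexible_restriction P i))"
      by (intro snoc.prems(2)) (auto simp: strict_prefix_def)
    then show "lab (x @ y) \<in> labels (flexible_restriction P i)"
      and "\<And>c. (x @ y) @ [c] \<in> V \<Longrightarrow> lab ((x @ y) @ [c]) \<in> labels (flexible_restriction P i)"
      by blast+
  qed (use snoc.prems(1) in simp)
  ultimately show ?case
    by auto
qed simp

section \<open>Locality\<close>

text \<open>\<open>D s\<close> consists of nodes that cannot distinguish the two runs within
  \<open>s\<close> rounds; messages cross one edge per round, so neighbours of
  \<open>D (Suc s)\<close> must lie in \<open>D s\<close>. The map \<pi> need only respect ports and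
  inputs there, not on the whole tree.\<close>

lemma state_after_local:
  assumes input: "\<And>w. w \<in> D 0 \<Longrightarrow>
      node_degree V (\<pi> w) = node_degree V w \<and> (\<pi> w = [] \<longleftrightarrow> w = [])"
    and anti: "\<And>s w. s < T \<Longrightarrow> w \<in> D (Suc s) \<Longrightarrow> w \<in> D s"
    and peers: "\<And>s w q. s < T \<Longrightarrow> w \<in> D (Suc s) \<Longrightarrow>
      peer V (\<pi> w) q = map_option (map_prod \<pi> id) (peer V w q)"
    and nbrs: "\<And>s w q u q'. s < T \<Longrightarrow> w \<in> D (Suc s) \<Longrightarrow> peer V w q = Some (u, q') \<Longrightarrow> u \<in> D s"
    and "w \<in> D s" "s \<le> T"
  shows "state_after A V (ident \<circ> \<pi>) (\<omega> \<circ> \<pi>) s w = state_after A V ident \<omega> s (\<pi> w)"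
  using assms(5-)
proof (induction s arbitrary: w)
  case 0
  then show ?case
    using input[of w] by (simp add: input_of_def)
next
  case (Suc s)
  have "map_option (\<lambda>(u, q'). alg_send A (state_after A V (ident \<circ> \<pi>) (\<omega> \<circ> \<pi>) s u) q') (peer V w q) =
        map_option (\<lambda>(u, q'). alg_send A (state_after A V ident \<omega> s u) q') (peer V (\<pi> w) q)" for q
  proof (cases "peer V w q")
    case (Some uq)
    obtain u q' where "uq = (u, q')"
      by fastforce
    moreover from this have "u \<in> D s"
      using Suc.prems Some nbrs[of s w q u q'] by auto
    ultimately show ?thesis
      using Suc.prems Suc.IH[of u] Some peers[of s w q] by (auto simp: comp_def)
  qed (use Suc.prems peers[of s w q] in auto)
  moreover have "state_after A V (ident \<circ> \<pi>) (\<omega> \<circ> \<pi>) s w = state_after A V ident \<omega> s (\<pi> w)"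
    using Suc.prems anti[of s w] by (intro Suc.IH) auto
  ultimately show ?case
    by (simp add: comp_def)
qed

lemma rounds_le_iff:
  "rounds A V ident \<omega> \<le> enat T \<longleftrightarrow> (\<forall>v\<in>V. \<exists>s\<le>T. has_output_at A V ident \<omega> v s)"
proof -
  have "(INF s\<in>{s. has_output_at A V ident \<omega> v s}. enat s) \<le> enat T \<longleftrightarrow>
        (\<exists>s\<le>T. has_output_at A V ident \<omega> v s)" for v
  proof
    assume le: "(INF s\<in>{s. has_output_at A V ident \<omega> v s}. enat s) \<le> enat T"
    let ?S = "enat ` {s. has_output_at A V ident \<omega> v s}"
    \<comment> \<open>The infimum over no times is infinite; over a nonempty set of times it is
      attained.\<close>
    have "?S \<noteq> {}"
      using le by (auto simp: Inf_enat_def split: if_splits)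
    then have "Inf ?S \<in> ?S"
      unfolding Inf_enat_def by (auto intro: LeastI)
    then show "\<exists>s\<le>T. has_output_at A V ident \<omega> v s"
      using le by auto
  qed (auto intro: INF_lower2)
  then show ?thesis
    unfolding rounds_def SUP_le_iff by blast
qed

text \<open>Since the first output counts, the states have to agree in every round up to
  \<open>T\<close>, not just in the last one.\<close>

lemma node_output_cong:
  assumes eq: "\<And>s. s \<le> T \<Longrightarrow>
      state_after A V ident \<omega> s v = state_after A V ident' \<omega>' s v'"
    and ex: "\<exists>s\<le>T. has_output_at A V ident \<omega> v s"
  shows "node_output A V ident \<omega> v = node_output A V ident' \<omega>' v'"
proof -
  let ?h = "has_output_at A V ident \<omega> v" and ?h' = "has_output_at A V ident' \<omega>' v'"
  have same: "?h s \<longleftrightarrow> ?h' s" if "s \<le> T" for s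
    using eq[OF that] by (simp add: has_output_at_def)
  obtain s where s: "s \<le> T" "?h s"
    using ex by blast
  then have T: "(LEAST s. ?h s) \<le> T"
    by (meson Least_le order_trans)
  have "?h (LEAST s. ?h s)"
    using s by (meson LeastI)
  then have "?h' (LEAST s. ?h s)"
    using same T by blast
  moreover have "(LEAST s. ?h' s) = (LEAST s. ?h s)"
  proof (rule Least_equality)
    show "?h' (LEAST s. ?h s)"
      by fact
    show "(LEAST s. ?h s) \<le> s" if "?h' s" for s
      using that same T by (metis Least_le linorder_le_cases order_trans)
  qed
  ultimately show ?thesis
    using s eq[OF T] unfolding node_output_def by metis
qed

text \<open>This replaces the ball around \<open>z @ y\<close>: for \<open>T \<le> length y\<close>
  and \<open>m = T + 1\<close> it contains all that \<open>z @ y\<close> can see in \<open>T\<close>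
  rounds, yet it is cut in only two places, at \<open>z\<close> and on the leftmost path below
  \<open>z @ y\<close>.\<close>

definition region :: "node set \<Rightarrow> node \<Rightarrow> node \<Rightarrow> nat \<Rightarrow> node set" where
  "region V z y m = {z @ x |x. z @ x \<in> V \<and> \<not> prefix (y @ replicate m 0) x}"

text \<open>The two nodes have the same view up to \<pi>. The isomorphism reaches one level beyond
  the region on which \<pi> is prescribed because a degree, known at the start, reveals which
  children exist.\<close>

lemma node_output_transport:
  assumes V: "full_tree \<delta> V" and root: "z \<noteq> []" "z' \<noteq> []" and y: "T \<le> length y" "z @ y \<in> V"
    and iso: "\<And>x. \<not> prefix (y @ replicate (T + 2) 0) x \<Longrightarrow> z @ x \<in> V \<longleftrightarrow> z' @ x \<in> V"
    and \<pi>: "\<And>x. z @ x \<in> region V z y (T + 1) \<Longrightarrow> \<pi> (z @ x) = z' @ x"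
    and out: "rounds A V (ident \<circ> \<pi>) (\<omega> \<circ> \<pi>) \<le> enat T"
  shows "node_output A V (ident \<circ> \<pi>) (\<omega> \<circ> \<pi>) (z @ y) = node_output A V ident \<omega> (z' @ y)"
proof -
  \<comment> \<open>Each round costs one level below \<open>z\<close> and one level above the cut.
    After \<open>T\<close> rounds \<open>z @ y\<close> is still left.\<close>
  define D where "D = (\<lambda>s. {z @ x |x. z @ x \<in> V \<and> s \<le> length x \<and>
    \<not> prefix (y @ replicate (T + 1 - s) 0) x})"
  have prefix_mono: "prefix (y @ replicate m 0) x" if "prefix (y @ replicate m' 0) x" "m \<le> m'"
    for m m' x
  proof -
    have "prefix (y @ replicate m 0) (y @ replicate m' (0::nat))"
      using that(2) by (metis le_add_diff_inverse prefixI replicate_add same_prefix_prefix)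
    then show ?thesis
      using that(1) by (rule prefix_order.trans)
  qed
  have \<pi>D: "\<pi> (z @ x) = z' @ x" if "z @ x \<in> D s" for x s
  proof (rule \<pi>)
    show "z @ x \<in> region V z y (T + 1)"
      using that prefix_mono[of "T + 1" x "T + 1 - s"] by (auto simp: D_def region_def)
  qed
  have child: "\<not> prefix (y @ replicate (Suc m) 0) (x @ [c])"
    if "\<not> prefix (y @ replicate m 0) x" for m x c
  proof
    have split: "y @ replicate (Suc m) 0 = (y @ replicate m 0) @ [0]"
      by (simp add: replicate_append_same)
    assume "prefix (y @ replicate (Suc m) 0) (x @ [c])"
    then have "prefix (y @ replicate m 0) x"
      unfolding split prefix_snoc append1_eq_conv by (metis append_prefixD prefix_order.refl)
    then show False
      using that by blast
  qed
  have iso_child: "z @ x @ [c] \<in> V \<longleftrightarrow> z' @ x @ [c] \<in> V" if "z @ x \<in> D s" for x c s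
  proof (rule iso)
    have "\<not> prefix (y @ replicate (T + 1) 0) x"
      using that prefix_mono[of "T + 1" x "T + 1 - s"] by (auto simp: D_def)
    then show "\<not> prefix (y @ replicate (T + 2) 0) (x @ [c])"
      using child by (simp add: eval_nat_numeral del: replicate_Suc)
  qed
  have step_child: "z @ x @ [c] \<in> D s" if "z @ x \<in> D (Suc s)" "z @ x @ [c] \<in> V" "s < T" for x c s
  proof -
    have "\<not> prefix (y @ replicate (Suc (T - s)) 0) (x @ [c])"
      using that by (intro child) (auto simp: D_def)
    then show ?thesis
      using that by (auto simp: D_def Suc_diff_le)
  qed
  have step_parent: "z @ butlast x \<in> D s" if "z @ x \<in> D (Suc s)" "s < T" for x s
  proof -
    have x: "x \<noteq> []"
      using that by (auto simp: D_def)
    then have "(z @ butlast x) @ [last x] \<in> V"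
      using that by (auto simp: D_def)
    then have "z @ butlast x \<in> V"
      using V unfolding full_tree_def by blast
    moreover have "\<not> prefix (y @ replicate (T + 1 - s) 0) (butlast x)"
    proof
      assume "prefix (y @ replicate (T + 1 - s) 0) (butlast x)"
      then have "prefix (y @ replicate (T - s) 0) x"
        by (meson le_add1 diff_le_mono prefixeq_butlast prefix_mono prefix_order.trans)
      then show False
        using that by (auto simp: D_def)
    qed
    ultimately show ?thesis
      using that x by (auto simp: D_def)
  qed
  have root_iff: "z @ x \<noteq> []" "z' @ x \<noteq> []" for x
    using root by auto
  have "state_after A V (ident \<circ> \<pi>) (\<omega> \<circ> \<pi>) s w = state_after A V ident \<omega> s (\<pi> w)"
    if "w \<in> D s" "s \<le> T" for s w
  proof (rule state_after_local[where D = D and T = T])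
    fix w assume w: "w \<in> D 0"
    then obtain x where x: "w = z @ x"
      by (auto simp: D_def)
    have "peer V (z' @ x) q \<noteq> None \<longleftrightarrow> peer V (z @ x) q \<noteq> None" for q
      using iso_child[OF w[unfolded x]] root by (cases q) auto
    then show "node_degree V (\<pi> w) = node_degree V w \<and> (\<pi> w = [] \<longleftrightarrow> w = [])"
      using root w unfolding x by (simp add: node_degree_def \<pi>D)
  next
    fix s w assume s: "s < T" and w: "w \<in> D (Suc s)"
    then obtain x where x: "w = z @ x" "x \<noteq> []"
      by (fastforce simp: D_def)
    show "w \<in> D s"
      using w prefix_mono[of "T + 1 - s" _ "T + 1 - Suc s"]
      by (auto simp: D_def intro: prefix_mono[of "T + 1 - s"])
    fix q
    show "peer V (\<pi> w) q = map_option (map_prod \<pi> id) (peer V w q)"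
    proof (cases q)
      case Parent
      then show ?thesis
        using x w root step_parent[of x s] s by (simp add: \<pi>D butlast_append)
    next
      case (Child i)
      then show ?thesis
        using x w step_child[of x s i] s iso_child[of x "Suc s" i] \<pi>D[of x "Suc s"] \<pi>D[of "x @ [i]" s]
        by auto
    qed
    fix u q' assume "peer V w q = Some (u, q')"
    then show "u \<in> D s"
      using x w s step_parent[of x s] step_child[of x s]
      by (cases q) (auto simp: butlast_append split: if_splits)
  qed fact+
  moreover have "z @ y \<in> D s" if "s \<le> T" for s
    using that y by (auto simp: D_def Suc_diff_le)
  moreover have "\<exists>s\<le>T. has_output_at A V (ident \<circ> \<pi>) (\<omega> \<circ> \<pi>) (z @ y) s"
    using out y unfolding rounds_le_iff by blast
  ultimately have "node_output A V (ident \<circ> \<pi>) (\<omega> \<circ> \<pi>) (z @ y) = node_output A V ident \<omega> (\<pi> (z @ y))"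
    by (intro node_output_cong[where T = T]) auto
  then show ?thesis
    using \<pi>D[of y 0] y by (simp add: D_def)
qed

text \<open>Turns a prescribed move of some identifiers and bits into a permutation of all nodes:
  the complements of \<open>S\<close> and of its image have equal size, so any bijection between
  them completes \<open>f\<close>.\<close>

lemma inj_on_extend_permutes:
  assumes V: "finite V" and S: "S \<subseteq> V" "inj_on f S" "f ` S \<subseteq> V"
  obtains \<pi> where "\<pi> permutes V" "\<And>x. x \<in> S \<Longrightarrow> \<pi> x = f x"
proof -
  have "card (V - S) = card (V - f ` S)"
    using assms by (simp add: card_Diff_subset finite_subset card_image)
  then obtain g where g: "bij_betw g (V - S) (V - f ` S)"
    using V finite_same_card_bij by (metis finite_Diff)
  let ?\<pi> = "\<lambda>x. if x \<in> S then f x else if x \<in> V then g x else x"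
  have "bij_betw ?\<pi> (S \<union> (V - S)) (f ` S \<union> (V - f ` S))"
  proof (rule bij_betw_combine)
    show "bij_betw ?\<pi> S (f ` S)"
      using S by (auto simp: bij_betw_def inj_on_def)
    show "bij_betw ?\<pi> (V - S) (V - f ` S)"
      using g by (subst bij_betw_cong[where g = g]) auto
  qed auto
  then have "bij_betw ?\<pi> V V"
    using S by (simp add: Un_absorb1)
  then have "?\<pi> permutes V"
    using S by (intro bij_imp_permutes) auto
  then show ?thesis
    using that[of ?\<pi>] by simp
qed

section \<open>Trees generated by node states\<close>

text \<open>Every node carries a state. Nodes in state \<open>0\<close> are leaves; the first child of a node in state
  \<open>h > 0\<close> is in state \<open>h - 1\<close>, its other children are in state \<open>L h\<close>. So equality of \<open>L\<close> on two
  intervals of states makes the corresponding segments of a leftmost path look alike.\<close>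

primrec reach :: "nat \<Rightarrow> (nat \<Rightarrow> nat) \<Rightarrow> nat \<Rightarrow> node \<Rightarrow> nat option" where
  "reach \<delta> L h [] = Some h"
| "reach \<delta> L h (c # y) =
     (if 0 < h \<and> c < \<delta> then reach \<delta> L (if c = 0 then h - 1 else L h) y else None)"

definition state_tree :: "nat \<Rightarrow> (nat \<Rightarrow> nat) \<Rightarrow> nat \<Rightarrow> node set" where
  "state_tree \<delta> L h = {y. reach \<delta> L h y \<noteq> None}"

lemma reach_append: "reach \<delta> L h (x @ y) = Option.bind (reach \<delta> L h x) (\<lambda>h'. reach \<delta> L h' y)"
  by (induction x arbitrary: h) auto

lemma reach_replicate: "0 < \<delta> \<Longrightarrow> m \<le> h \<Longrightarrow> reach \<delta> L h (replicate m 0) = Some (h - m)"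
  by (induction m arbitrary: h) auto

lemma reach_length_le:
  assumes "\<And>h. 0 < h \<Longrightarrow> L h < h" and "reach \<delta> L h y = Some h'"
  shows "h' + length y \<le> h"
  using assms(2)
proof (induction y arbitrary: h)
  case (Cons c y)
  then have "h' + length y \<le> (if c = 0 then h - 1 else L h)" "0 < h"
    by (auto split: if_splits)
  then show ?case
    using assms(1)[of h] by (auto split: if_splits)
qed auto

lemma reach_prefix:
  assumes "\<And>h. 0 < h \<Longrightarrow> L h < h" and "reach \<delta> L h y = Some h'" and "prefix x y"
  obtains h'' where "reach \<delta> L h x = Some h''" "h' + (length y - length x) \<le> h''"
proof -
  obtain z where z: "y = x @ z"
    using assms(3) by (auto simp: prefix_def)
  then obtain h'' where "reach \<delta> L h x = Some h''" "reach \<delta> L h'' z = Some h'"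
    using assms(2) by (auto simp: reach_append bind_eq_Some_conv)
  then show ?thesis
    using that reach_length_le[OF assms(1)] z by fastforce
qed

lemma state_tree_0: "state_tree \<delta> L 0 = {[]}"
proof -
  have "reach \<delta> L 0 y \<noteq> None \<longleftrightarrow> y = []" for y
    by (cases y) auto
  then show ?thesis
    by (auto simp: state_tree_def)
qed

lemma state_tree_pos:
  assumes "0 < h"
  shows "state_tree \<delta> L h =
    insert [] (\<Union>c\<in>{..<\<delta>}. (#) c ` state_tree \<delta> L (if c = 0 then h - 1 else L h))"
proof -
  have "y \<in> state_tree \<delta> L h \<longleftrightarrow>
      y \<in> insert [] (\<Union>c\<in>{..<\<delta>}. (#) c ` state_tree \<delta> L (if c = 0 then h - 1 else L h))" for y
    using assms by (cases y) (auto simp: state_tree_def split: if_splits)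
  then show ?thesis
    by blast
qed

lemma finite_state_tree:
  assumes "\<And>h. 0 < h \<Longrightarrow> L h < h"
  shows "finite (state_tree \<delta> L h)"
proof (induction h rule: less_induct)
  case (less h)
  show ?case
  proof (cases "h = 0")
    case False
    then have "finite (state_tree \<delta> L (if c = 0 then h - 1 else L h))" for c :: nat
      using less assms by auto
    then show ?thesis
      using False by (subst state_tree_pos) auto
  qed (simp add: state_tree_0)
qed

lemma full_tree_state_tree:
  assumes "\<And>h. 0 < h \<Longrightarrow> L h < h"
  shows "full_tree \<delta> (state_tree \<delta> L h)"
  unfolding full_tree_def
proof (intro conjI allI impI ballI)
  show "finite (state_tree \<delta> L h)"
    by (rule finite_state_tree) fact
  show "v \<in> state_tree \<delta> L h" if "v @ [i] \<in> state_tree \<delta> L h" for v i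
    using that by (auto simp: state_tree_def reach_append bind_eq_Some_conv)
  fix v assume "v \<in> state_tree \<delta> L h"
  then obtain h' where "reach \<delta> L h v = Some h'"
    by (auto simp: state_tree_def)
  then have "v @ [i] \<in> state_tree \<delta> L h \<longleftrightarrow> 0 < h' \<and> i < \<delta>" for i
    by (simp add: state_tree_def reach_append)
  then show "{i. v @ [i] \<in> state_tree \<delta> L h} = {..<\<delta>} \<or> {i. v @ [i] \<in> state_tree \<delta> L h} = {}"
    by (cases "0 < h'") auto
qed (simp add: state_tree_def)

lemma card_state_tree_pos:
  assumes L: "\<And>h. 0 < h \<Longrightarrow> L h < h" and h: "0 < h" and \<delta>: "0 < \<delta>"
  shows "card (state_tree \<delta> L h) =
    1 + card (state_tree \<delta> L (h - 1)) + (\<delta> - 1) * card (state_tree \<delta> L (L h))"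
proof -
  let ?S = "\<lambda>c. state_tree \<delta> L (if c = (0::nat) then h - 1 else L h)"
  have "card (state_tree \<delta> L h) = Suc (card (\<Union>c\<in>{..<\<delta>}. (#) c ` ?S c))"
    using finite_state_tree[of L, OF L] by (subst state_tree_pos[OF h], subst card_insert_disjoint) auto
  also have "card (\<Union>c\<in>{..<\<delta>}. (#) c ` ?S c) = (\<Sum>c<\<delta>. card ((#) c ` ?S c))"
    using finite_state_tree[of L, OF L] by (intro card_UN_disjoint) auto
  also have "\<dots> = (\<Sum>c<\<delta>. card (?S c))"
    by (intro sum.cong refl card_image) auto
  also have "\<dots> = (\<Sum>c\<in>insert 0 {1..<\<delta>}. card (?S c))"
    using \<delta> by (intro sum.cong) auto
  also have "\<dots> = card (?S 0) + (\<Sum>c\<in>{1..<\<delta>}. card (?S c))"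
    by simp
  also have "(\<Sum>c\<in>{1..<\<delta>}. card (?S c)) = (\<Sum>c\<in>{1..<\<delta>}. card (state_tree \<delta> L (L h)))"
    by (intro sum.cong) auto
  finally show ?thesis
    by simp
qed

text \<open>Such an \<open>x\<close> either is a run of fewer than \<open>m\<close> zeros, present
  in both trees, or leaves the leftmost path at some depth \<open>j < m\<close>. In the latter case
  both trees continue from the same state \<open>L (h - j) = L (h' - j)\<close>.\<close>

lemma reach_iso:
  assumes "\<And>j. j < m \<Longrightarrow> L (h - j) = L (h' - j)" "m \<le> h" "m \<le> h'" "\<not> prefix (replicate m 0) x"
  shows "reach \<delta> L h x = None \<longleftrightarrow> reach \<delta> L h' x = None"
  using assms
proof (induction x arbitrary: m h h')
  case (Cons c x)
  obtain m' where m: "m = Suc m'"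
    using Cons.prems(4) by (cases m) auto
  have "L h = L h'"
    using Cons.prems(1)[of 0] m by simp
  moreover have "reach \<delta> L (h - 1) x = None \<longleftrightarrow> reach \<delta> L (h' - 1) x = None" if "c = 0"
  proof (rule Cons.IH[of m'])
    show "L (h - 1 - j) = L (h' - 1 - j)" if "j < m'" for j
      using Cons.prems(1)[of "Suc j"] that m by simp
  qed (use Cons.prems that m in auto)
  ultimately show ?case
    using Cons.prems m by auto
qed auto

text \<open>Every node but the root is a child of exactly one node that has \<delta>
  children.\<close>

lemma card_full_tree:
  assumes "full_tree \<delta> V"
  obtains m where "card V = 1 + \<delta> * m"
proof -
  define I where "I = {v \<in> V. {i. v @ [i] \<in> V} = {..<\<delta>}}"
  have fin: "finite V"
    using assms by (simp add: full_tree_def)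
  have "V = insert [] ((\<lambda>(v, i). v @ [i]) ` (I \<times> {..<\<delta>}))"
  proof (intro equalityI subsetI)
    fix w assume w: "w \<in> V"
    show "w \<in> insert [] ((\<lambda>(v, i). v @ [i]) ` (I \<times> {..<\<delta>}))"
    proof (cases w rule: rev_cases)
      case (snoc v i)
      then have "v \<in> V"
        using w assms unfolding full_tree_def by blast
      moreover have "i \<in> {i. v @ [i] \<in> V}"
        using w snoc by simp
      ultimately have "v \<in> I" "i < \<delta>"
        using assms unfolding full_tree_def I_def by blast+
      then show ?thesis
        using snoc by auto
    qed simp
  next
    fix w assume "w \<in> insert [] ((\<lambda>(v, i). v @ [i]) ` (I \<times> {..<\<delta>}))"
    then show "w \<in> V"
      using assms by (auto simp: full_tree_def I_def)
  qed
  then have "card V = Suc (card ((\<lambda>(v, i). v @ [i]) ` (I \<times> {..<\<delta>})))"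
    using fin by (metis (no_types, lifting) I_def card_insert_disjoint finite_SigmaI finite_imageI
        finite_lessThan finite_subset imageE mem_Collect_eq old.prod.case snoc_eq_iff_butlast
        subsetI surj_pair)
  also have "card ((\<lambda>(v, i). v @ [i]) ` (I \<times> {..<\<delta>})) = card (I \<times> {..<\<delta>})"
    by (rule card_image) (auto simp: inj_on_def)
  also have "\<dots> = \<delta> * card I"
    by (simp add: card_cartesian_product)
  finally show ?thesis
    by (intro that[of "card I"]) simp
qed

section \<open>The hard instance\<close>

text \<open>Leftmost paths are divided into segments of \<open>t\<close> nodes. At the nodes of a segment of rank \<open>i\<close> hang
  trees whose root has state \<open>i * t\<close>, which start with a segment of rank \<open>i - 1\<close>. Below state
  \<open>(k + 1) * t\<close> the ranks decrease towards the leaf. The stem above it runs through the ranks in the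
  reverse order, so that the nodes in between lie below one segment of rank \<open>i\<close> and above another.
  Above state \<open>(2 * k + 1) * t\<close>, only leaves hang off the stem (the subtraction from \<open>k - 1\<close>
  truncates), which pads the tree to any possible size.\<close>

definition light :: "nat \<Rightarrow> nat \<Rightarrow> nat \<Rightarrow> nat" where
  "light k t h =
     (if h \<le> (k + 1) * t then t * ((h - 1) div t)
      else t * (k - 1 - (h - (k + 1) * t - 1) div t))"

lemma light_less: "0 < h \<Longrightarrow> light k t h < h"
proof (cases "h \<le> (k + 1) * t")
  case True
  assume "0 < h"
  have "t * ((h - 1) div t) \<le> h - 1"
    by simp
  also have "\<dots> < h"
    using \<open>0 < h\<close> by simp
  finally show ?thesis
    using True by (simp add: light_def)
next
  case False
  have "t * (k - 1 - (h - (k + 1) * t - 1) div t) \<le> t * (k + 1)"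
    by (intro mult_le_mono) auto
  also have "\<dots> < h"
    using False by (simp add: mult.commute)
  finally show ?thesis
    using False by (simp add: light_def)
qed

text \<open>Between the two segments of rank \<open>i\<close>, inclusive, no segment has a smaller
  rank. This keeps the children of nodes of \<open>good_nodes\<close> from falling below state
  \<open>i * t\<close>.\<close>

lemma light_ge:
  assumes "i \<le> k" "i * t < h" "h \<le> (2 * k + 1 - i) * t"
  shows "i * t \<le> light k t h"
proof (cases "h \<le> (k + 1) * t")
  case True
  have "0 < t"
    using assms by (cases t) auto
  then have "i \<le> (h - 1) div t"
    using assms by (simp add: less_eq_div_iff_mult_less_eq)
  then show ?thesis
    using True by (simp add: light_def mult.commute)
next
  case False
  define x where "x = h - (k + 1) * t"
  have "x > 0"
    using False by (simp add: x_def)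
  have "2 * k + 1 - i = (k + 1) + (k - i)"
    using assms(1) by simp
  then have "(2 * k + 1 - i) * t = (k + 1) * t + (k - i) * t"
    by (simp only: distrib_right)
  then have x: "x \<le> (k - i) * t"
    using assms False by (simp add: x_def)
  then have "(x - 1) div t < k - i"
    using \<open>x > 0\<close> by (cases "t = 0") (auto simp: div_less_iff_less_mult)
  then have "i \<le> k - 1 - (x - 1) div t"
    by linarith
  then show ?thesis
    using False by (simp add: light_def mult.commute[of i] x_def)
qed

lemma light_lower:
  assumes "i \<le> k" "i * t < h" "h \<le> (i + 1) * t"
  shows "light k t h = t * i"
proof -
  have "(h - 1) div t = i"
    using assms by (intro div_nat_eqI) (auto simp: algebra_simps)
  moreover have "h \<le> (k + 1) * t"
    using assms(1,3) by (meson add_le_mono1 le_trans mult_le_mono1)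
  ultimately show ?thesis
    by (simp add: light_def)
qed

text \<open>The stem segment of rank \<open>i\<close>, counterpart of the one in
  \<open>light_lower\<close>. That \<open>light\<close> has the same value on both lets views be
  moved from one to the other.\<close>

lemma light_upper:
  assumes "i < k" "(2 * k - i) * t < h" "h \<le> (2 * k - i) * t + t"
  shows "light k t h = t * i"
proof -
  define x where "x = h - (k + 1) * t"
  have "2 * k - i = (k + 1) + (k - 1 - i)"
    using assms(1) by simp
  then have *: "(2 * k - i) * t = (k + 1) * t + (k - 1 - i) * t"
    by (simp only: distrib_right)
  then have h: "h > (k + 1) * t"
    using assms by linarith
  have "(x - 1) div t = k - 1 - i"
    using assms * by (intro div_nat_eqI) (auto simp: algebra_simps x_def)
  then have "k - 1 - (x - 1) div t = i"
    using assms(1) by linarith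
  then show ?thesis
    using h by (simp add: light_def x_def)
qed

lemma light_top:
  assumes "(2 * k + 1) * t < h" "0 < t"
  shows "light k t h = 0"
proof -
  have "(2 * k + 1) * t = (k + 1) * t + k * t"
    by (simp add: algebra_simps)
  then have h: "h > (k + 1) * t" and "k * t \<le> h - (k + 1) * t - 1"
    using assms by linarith+
  then have "k \<le> (h - (k + 1) * t - 1) div t"
    using assms(2) by (simp add: less_eq_div_iff_mult_less_eq)
  then have "k - 1 - (h - (k + 1) * t - 1) div t = 0"
    by linarith
  then show ?thesis
    using h by (simp add: light_def)
qed

section \<open>Sizes of the hard trees\<close>

abbreviation hard_tree :: "nat \<Rightarrow> nat \<Rightarrow> nat \<Rightarrow> nat \<Rightarrow> node set" where
  "hard_tree \<delta> k t \<equiv> state_tree \<delta> (light k t)"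

lemma card_hard_tree_pos:
  assumes "0 < h" "0 < \<delta>"
  shows "card (hard_tree \<delta> k t h) =
    1 + card (hard_tree \<delta> k t (h - 1)) + (\<delta> - 1) * card (hard_tree \<delta> k t (light k t h))"
  using light_less assms by (rule card_state_tree_pos)

text \<open>One more level of a leftmost path adds a node and \<delta> - 1 side trees, each of size
  at most \<open>b\<close>, so at most \<open>b * \<delta>\<close> nodes.\<close>

lemma card_step_bound:
  fixes a b c e \<delta> j :: nat
  assumes "a \<le> b * (1 + j * \<delta>)" "c \<le> b" "0 < \<delta>" "1 \<le> b"
  shows "1 + a + (\<delta> - 1) * c \<le> b * (1 + Suc j * \<delta>)"
proof -
  have "1 + a + (\<delta> - 1) * c \<le> b + b * (1 + j * \<delta>) + (\<delta> - 1) * b"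
    using assms by (intro add_mono mult_le_mono) auto
  also have "\<dots> = b * (1 + j * \<delta>) + (1 + (\<delta> - 1)) * b"
    by (simp only: distrib_right)
  also have "\<dots> = b * (1 + Suc j * \<delta>)"
    using assms(3) by (simp add: algebra_simps)
  finally show ?thesis .
qed

text \<open>The side trees along the segment of rank \<open>r\<close> start in state
  \<open>r * t\<close>, so passing through a full segment multiplies the bound by
  \<open>1 + t * \<delta>\<close>. The size is thus polynomial in \<open>t\<close>, with the rank as
  exponent.\<close>

lemma card_hard_tree_lower:
  assumes \<delta>: "0 < \<delta>" and "r \<le> k" "j \<le> t"
  shows "card (hard_tree \<delta> k t (r * t + j)) \<le> (1 + t * \<delta>) ^ r * (1 + j * \<delta>)"
proof -
  have step: "card (hard_tree \<delta> k t (r * t + j)) \<le> (1 + t * \<delta>) ^ r * (1 + j * \<delta>)"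
    if base: "card (hard_tree \<delta> k t (r * t)) \<le> (1 + t * \<delta>) ^ r" and "r \<le> k" "j \<le> t" for r j
    using that(3)
  proof (induction j)
    case (Suc j)
    have "light k t (r * t + Suc j) = t * r"
      using Suc.prems \<open>r \<le> k\<close> by (intro light_lower) auto
    then have "card (hard_tree \<delta> k t (r * t + Suc j)) =
        1 + card (hard_tree \<delta> k t (r * t + j)) + (\<delta> - 1) * card (hard_tree \<delta> k t (r * t))"
      using \<delta> by (subst card_hard_tree_pos) (auto simp: mult.commute)
    also have "\<dots> \<le> (1 + t * \<delta>) ^ r * (1 + Suc j * \<delta>)"
      using Suc base \<delta> by (intro card_step_bound) auto
    finally show ?case .
  qed (use base in simp)
  have "card (hard_tree \<delta> k t (r * t)) \<le> (1 + t * \<delta>) ^ r"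
    using assms(2)
  proof (induction r)
    case (Suc r)
    then show ?case
      using step[of r t] by (simp add: add.commute mult.commute)
  qed (simp add: state_tree_0)
  then show ?thesis
    using assms(2,3) by (rule step)
qed

text \<open>Ranks do not grow along the stem, so its side trees stay within the size reached at its
  lower end and the growth is linear in \<open>x\<close>.\<close>

lemma card_hard_tree_stem:
  assumes \<delta>: "0 < \<delta>"
  shows "card (hard_tree \<delta> k t ((k + 1) * t + x)) \<le> (1 + t * \<delta>) ^ (k + 1) * (1 + x * \<delta>)"
proof (induction x)
  case 0
  show ?case
    using card_hard_tree_lower[OF \<delta>, of k k t t] by (simp add: algebra_simps)
next
  case (Suc x)
  define r where "r = k - 1 - x div t"
  have "light k t ((k + 1) * t + Suc x) = r * t"
    by (simp add: light_def r_def mult.commute)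
  then have "card (hard_tree \<delta> k t ((k + 1) * t + Suc x)) =
      1 + card (hard_tree \<delta> k t ((k + 1) * t + x)) + (\<delta> - 1) * card (hard_tree \<delta> k t (r * t))"
    using \<delta> by (subst card_hard_tree_pos) auto
  also have "card (hard_tree \<delta> k t (r * t)) \<le> (1 + t * \<delta>) ^ (k + 1)"
  proof -
    have "card (hard_tree \<delta> k t (r * t)) \<le> (1 + t * \<delta>) ^ r"
      using card_hard_tree_lower[OF \<delta>, of r k 0 t] by (simp add: r_def)
    also have "\<dots> \<le> (1 + t * \<delta>) ^ (k + 1)"
      by (intro power_increasing) (auto simp: r_def)
    finally show ?thesis .
  qed
  then have "1 + card (hard_tree \<delta> k t ((k + 1) * t + x)) +
      (\<delta> - 1) * card (hard_tree \<delta> k t (r * t)) \<le> (1 + t * \<delta>) ^ (k + 1) * (1 + Suc x * \<delta>)"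
    using Suc \<delta> by (intro card_step_bound one_le_power) simp_all
  finally show ?case .
qed

lemma card_hard_tree_top:
  assumes \<delta>: "0 < \<delta>" and t: "0 < t"
  shows "card (hard_tree \<delta> k t ((2 * k + 1) * t + x)) = card (hard_tree \<delta> k t ((2 * k + 1) * t)) + x * \<delta>"
proof (induction x)
  case (Suc x)
  have "light k t ((2 * k + 1) * t + Suc x) = 0"
    using t by (intro light_top) auto
  then show ?case
    using \<delta> Suc by (subst card_hard_tree_pos) (auto simp: state_tree_0)
qed simp

text \<open>All sizes of full trees are 1 modulo \<delta>, and each padding level adds exactly
  \<delta> nodes, so every possible size from some point on is hit.\<close>

lemma hard_tree_of_size:
  assumes n: "n \<in> tree_sizes \<delta>" and \<delta>: "0 < \<delta>" and t: "0 < t"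
    and le: "(1 + t * \<delta>) ^ (k + 1) * (1 + (k * t + 1) * \<delta>) \<le> n"
  obtains N where "(2 * k + 1) * t < N" "card (hard_tree \<delta> k t N) = n"
proof -
  obtain m where m: "n = 1 + \<delta> * m"
    using n card_full_tree unfolding tree_sizes_def by (metis (no_types, lifting) imageE mem_Collect_eq)
  have full: "full_tree \<delta> (hard_tree \<delta> k t h)" for h
    by (rule full_tree_state_tree[OF light_less])
  \<comment> \<open>Starting one level above \<open>(2 * k + 1) * t\<close> makes the inequality for
    \<open>N\<close> strict, so the node at the top of the highest segment is not the root.\<close>
  let ?b = "card (hard_tree \<delta> k t ((2 * k + 1) * t + 1))"
  obtain m' where m': "?b = 1 + \<delta> * m'"
    by (rule card_full_tree[OF full])
  have "?b \<le> n"
  proof -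
    have "(2 * k + 1) * t + 1 = (k + 1) * t + (k * t + 1)"
      by (simp add: mult_2 distrib_right)
    then show ?thesis
      using order_trans[OF card_hard_tree_stem[OF \<delta>, of k t "k * t + 1"] le] by (simp only:)
  qed
  then have "\<delta> * m' \<le> \<delta> * m"
    using m m' by linarith
  then have "m' \<le> m"
    using \<delta> by simp
  have "card (hard_tree \<delta> k t ((2 * k + 1) * t + (1 + (m - m')))) = ?b + (m - m') * \<delta>"
    unfolding card_hard_tree_top[OF \<delta> t] by (simp add: algebra_simps)
  also have "\<dots> = 1 + \<delta> * (m' + (m - m'))"
    unfolding m' by (simp add: algebra_simps)
  also have "\<dots> = n"
    using \<open>m' \<le> m\<close> m by simp
  finally show ?thesis
    by (rule that[rotated]) simp
qed

text \<open>The sets \<open>G\<^sub>i\<close>: the nodes in states \<open>\<ge> i * t\<close> below the segment of rank \<open>i - 1\<close> of the stem.\<close>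

definition good_nodes :: "nat \<Rightarrow> nat \<Rightarrow> nat \<Rightarrow> nat \<Rightarrow> nat \<Rightarrow> node set" where
  "good_nodes \<delta> k t N i =
     {replicate (N - (2 * k + 1 - i) * t) 0 @ y |y h.
        reach \<delta> (light k t) ((2 * k + 1 - i) * t) y = Some h \<and> i * t \<le> h}"

text \<open>\<open>D\<close> is to be the view that stays fixed; it must avoid the target region as
  well as the source, or the combined map would not be injective. The source and the target
  themselves may overlap, as they do for a node and its child.\<close>

lemma region_transfer_permutes:
  assumes V: "finite V" and D: "D \<subseteq> V" "D \<inter> region V a y m = {}" "D \<inter> region V a' y m = {}"
    and iso: "\<And>x. \<not> prefix (y @ replicate m 0) x \<Longrightarrow> a @ x \<in> V \<longleftrightarrow> a' @ x \<in> V"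
  obtains \<pi> where "\<pi> permutes V" "\<And>w. w \<in> D \<Longrightarrow> \<pi> w = w"
    "\<And>x. a @ x \<in> region V a y m \<Longrightarrow> \<pi> (a @ x) = a' @ x"
proof -
  let ?R = "region V a y m" and ?R' = "region V a' y m"
  define f where "f = (\<lambda>w. if w \<in> D then w else a' @ drop (length a) w)"
  have sub: "?R \<subseteq> V" "?R' \<subseteq> V"
    by (auto simp: region_def)
  have fR: "f w \<in> ?R'" if w: "w \<in> ?R" for w
  proof -
    obtain x where "w = a @ x" "a @ x \<in> V" "\<not> prefix (y @ replicate m 0) x"
      using w unfolding region_def by blast
    moreover have "w \<notin> D"
      using w D by blast
    ultimately show ?thesis
      using iso by (auto simp: f_def region_def)
  qed
  have fD: "f w = w" if "w \<in> D" for w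
    using that by (simp add: f_def)
  have "inj_on f ?R"
  proof (rule inj_onI)
    fix w w' assume w: "w \<in> ?R" "w' \<in> ?R" and eq: "f w = f w'"
    then have "w \<notin> D" "w' \<notin> D"
      using D(2) by blast+
    then have "drop (length a) w = drop (length a) w'"
      using eq by (simp add: f_def)
    then show "w = w'"
      using w by (auto simp: region_def)
  qed
  moreover have "inj_on f D"
    using fD by (simp add: inj_on_def)
  moreover have "f ` D \<subseteq> D"
    using fD by auto
  have "f ` (D - ?R) \<inter> f ` (?R - D) \<subseteq> D \<inter> ?R'"
    using fD fR by (intro Int_mono image_subsetI) auto
  then have "f ` (D - ?R) \<inter> f ` (?R - D) = {}"
    unfolding D(3) by simp
  ultimately have "inj_on f (D \<union> ?R)"
    by (simp add: inj_on_Un)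
  moreover have "f ` (D \<union> ?R) \<subseteq> V"
    using \<open>f ` D \<subseteq> D\<close> fR D(1) sub by blast
  moreover have "D \<union> ?R \<subseteq> V"
    using D(1) sub by blast
  ultimately obtain \<pi> where \<pi>: "\<pi> permutes V" "\<And>w. w \<in> D \<union> ?R \<Longrightarrow> \<pi> w = f w"
    using inj_on_extend_permutes[OF V] by metis
  show ?thesis
  proof (rule that[OF \<pi>(1)])
    show "\<pi> w = w" if "w \<in> D" for w
      using that \<pi>(2) fD by simp
    show "\<pi> (a @ x) = a' @ x" if "a @ x \<in> ?R" for x
      using that \<pi>(2)[of "a @ x"] D(2) by (auto simp: f_def)
  qed
qed

lemma good_nodes_subset:
  assumes \<delta>: "0 < \<delta>" and N: "(2 * k + 1) * t < N"
  shows "good_nodes \<delta> k t N i \<subseteq> hard_tree \<delta> k t N"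
proof -
  have "(2 * k + 1 - i) * t \<le> (2 * k + 1) * t"
    by (intro mult_le_mono1) simp
  then have "(2 * k + 1 - i) * t \<le> N"
    using N by linarith
  then show ?thesis
    by (auto simp: good_nodes_def state_tree_def reach_append reach_replicate[OF \<delta>])
qed

lemma good_nodes_child:
  assumes "i \<le> k" "reach \<delta> (light k t) ((2 * k + 1 - i) * t) y = Some h" "i * t < h" "c < \<delta>"
  shows "(replicate (N - (2 * k + 1 - i) * t) 0 @ y) @ [c] \<in> good_nodes \<delta> k t N i"
proof -
  have "h + length y \<le> (2 * k + 1 - i) * t"
    using light_less assms(2) by (rule reach_length_le)
  then have "i * t \<le> (if c = 0 then h - 1 else light k t h)"
    using assms light_ge[of i k t h] by auto
  moreover have "reach \<delta> (light k t) ((2 * k + 1 - i) * t) (y @ [c]) =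
      Some (if c = 0 then h - 1 else light k t h)"
    using assms by (simp add: reach_append)
  ultimately show ?thesis
    unfolding good_nodes_def append_assoc by blast
qed

text \<open>Here \<open>v\<close> keeps its view under \<open>\<pi>\<^sub>2\<close> and \<open>\<pi>\<^sub>3\<close>, while the view of \<open>u\<^sub>1\<close> moves to its child under \<open>\<pi>\<^sub>2\<close>
  and to \<open>v @ y\<^sub>3\<close> under \<open>\<pi>\<^sub>3\<close>.\<close>

lemma transplant:
  fixes \<delta> k T N i v
  defines "t \<equiv> 3 * T + 3"
  defines "V \<equiv> hard_tree \<delta> k t N"
  assumes \<delta>: "0 < \<delta>" and N: "(2 * k + 1) * t < N" and i: "i < k"
    and v: "v \<in> good_nodes \<delta> k t N (Suc i)"
  obtains u\<^sub>1 y\<^sub>1 y\<^sub>2 y\<^sub>3 \<pi>\<^sub>2 \<pi>\<^sub>3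
  where "v = u\<^sub>1 @ y\<^sub>1" "v = (u\<^sub>1 @ [0]) @ y\<^sub>2" "y\<^sub>3 \<noteq> []" "v @ y\<^sub>3 \<in> V"
    "\<pi>\<^sub>2 permutes V" "\<pi>\<^sub>3 permutes V"
    "length (v @ y\<^sub>3) \<le> length u\<^sub>1 + (2 * k + 1) * t"
    "\<And>w. prefix u\<^sub>1 w \<Longrightarrow> strict_prefix w (v @ y\<^sub>3) \<Longrightarrow>
      w \<in> good_nodes \<delta> k t N i \<and> (\<forall>c<\<delta>. w @ [c] \<in> good_nodes \<delta> k t N i)"
    "\<And>(A :: ('r, 'l) local_algorithm) ident \<omega>. rounds A V (ident \<circ> \<pi>\<^sub>2) (\<omega> \<circ> \<pi>\<^sub>2) \<le> enat T \<Longrightarrow>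
      node_output A V (ident \<circ> \<pi>\<^sub>2) (\<omega> \<circ> \<pi>\<^sub>2) v = node_output A V ident \<omega> v \<and>
      node_output A V (ident \<circ> \<pi>\<^sub>2) (\<omega> \<circ> \<pi>\<^sub>2) (u\<^sub>1 @ [0]) = node_output A V ident \<omega> u\<^sub>1"
    "\<And>(A :: ('r, 'l) local_algorithm) ident \<omega>. rounds A V (ident \<circ> \<pi>\<^sub>3) (\<omega> \<circ> \<pi>\<^sub>3) \<le> enat T \<Longrightarrow>
      node_output A V (ident \<circ> \<pi>\<^sub>3) (\<omega> \<circ> \<pi>\<^sub>3) v = node_output A V ident \<omega> v \<and>
      node_output A V (ident \<circ> \<pi>\<^sub>3) (\<omega> \<circ> \<pi>\<^sub>3) (v @ y\<^sub>3) = node_output A V ident \<omega> u\<^sub>1"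
proof -
  let ?L = "light k t" and ?zs = "\<lambda>m. replicate m (0::nat)"
  \<comment> \<open>The node in state \<open>B\<close> on the stem is the top of the nodes for
    \<open>Suc i\<close>; the stem segment of rank \<open>i\<close>, in states \<open>B + 1\<close>
    to \<open>B + t\<close>, lies directly above it.\<close>
  define B where "B = (2 * k - i) * t"
  have B: "(2 * k + 1 - Suc i) * t = B" "(2 * k + 1 - i) * t = B + t"
    using i by (auto simp: B_def Suc_diff_le)
  have BN: "B + t < N"
  proof -
    have "B + t \<le> (2 * k + 1) * t"
      unfolding B(2)[symmetric] by (intro mult_le_mono1) simp
    then show ?thesis
      using N by linarith
  qed
  have Bi: "(i + 1) * t \<le> B"
    unfolding B_def using i by (intro mult_le_mono1) simp
  obtain y h where y: "v = ?zs (N - B) @ y" "reach \<delta> ?L B y = Some h" and h: "Suc i * t \<le> h"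
    using v unfolding good_nodes_def B by blast
  \<comment> \<open>Below \<open>v\<close> the leftmost path runs through the lower segment of rank
    \<open>i\<close>. Its \<open>t = (T + 1) + (2 * T + 2)\<close> levels are split: the first
    \<open>T + 1\<close> keep the copy out of sight of \<open>v\<close>, the others hold the view of
    the copy.\<close>
  define s where "s = (i + 1) * t - T - 1"
  define e where "e = h - s"
  have s: "i * t + 2 * T + 2 = s" and e: "T + 1 \<le> e" "h = s + e"
    using h by (auto simp: s_def e_def t_def)
  have ft: "full_tree \<delta> V"
    unfolding V_def by (rule full_tree_state_tree[OF light_less])
  then have fin: "finite V"
    by (simp add: full_tree_def)
  have reach_V: "w \<in> V \<longleftrightarrow> reach \<delta> ?L N w \<noteq> None" for w
    by (simp add: V_def state_tree_def)
  have zs_add: "?zs m @ ?zs m' = ?zs (m + m')" for m m'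
    by (simp add: replicate_add)
  have reach_zs: "m \<le> h' \<Longrightarrow> reach \<delta> ?L h' (?zs m @ x) = reach \<delta> ?L (h' - m) x" for m h' x
    using reach_replicate[OF \<delta>] by (simp add: reach_append)

  \<comment> \<open>The tops of the three regions to be compared, in states \<open>B + t\<close>,
    \<open>B + t - 1\<close> and \<open>s\<close>. The nodes whose outputs matter lie
    \<open>T\<close> levels below them.\<close>
  define a\<^sub>1 a\<^sub>2 a\<^sub>3 where "a\<^sub>1 = ?zs (N - (B + t))" and "a\<^sub>2 = ?zs (N - (B + t) + 1)"
    and "a\<^sub>3 = v @ ?zs e"
  \<comment> \<open>Starting \<open>T\<close> levels above state \<open>B\<close> gives
    \<open>q\<close> length at least \<open>T\<close> even if \<open>y\<close> is empty.\<close>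
  define z q where "z = ?zs (N - (B + T))" and "q = ?zs T @ y"
  have v_zs: "v = ?zs m @ ?zs (N - B - m) @ y" if "m \<le> N - B" for m
    using y(1) that by (simp flip: append_assoc replicate_add)
  have vz: "v = z @ q"
    using v_zs[of "N - (B + T)"] BN by (simp add: z_def q_def t_def)
  have a\<^sub>1V: "a\<^sub>1 @ x \<in> V \<longleftrightarrow> reach \<delta> ?L (B + t) x \<noteq> None" for x
    using BN by (simp add: reach_V a\<^sub>1_def reach_zs)
  have a\<^sub>2V: "a\<^sub>2 @ x \<in> V \<longleftrightarrow> reach \<delta> ?L (B + t - 1) x \<noteq> None" for x
  proof -
    have "N - (B + t) + 1 \<le> N" "N - (N - (B + t) + 1) = B + t - 1"
      using BN by (auto simp: t_def)
    then show ?thesis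
      using reach_zs[of "N - (B + t) + 1" N x] unfolding reach_V a\<^sub>2_def by simp
  qed
  have a\<^sub>3V: "a\<^sub>3 @ x \<in> V \<longleftrightarrow> reach \<delta> ?L s x \<noteq> None" for x
  proof -
    have "reach \<delta> ?L N (a\<^sub>3 @ x) = reach \<delta> ?L s x"
      using BN y e by (simp add: a\<^sub>3_def reach_zs) (simp add: reach_append[of _ _ _ y] reach_zs)
    then show ?thesis
      by (simp add: reach_V)
  qed
  have L\<^sub>1: "?L (B + t - j) = t * i" if "j < t" for j
    using i that by (intro light_upper) (auto simp flip: B_def)
  have L\<^sub>3: "?L (s - j) = t * i" if "j < T + (T + 2)" for j
    using i that s by (intro light_lower) (auto simp: s_def t_def)
  have iso\<^sub>2: "a\<^sub>2 @ x \<in> V \<longleftrightarrow> a\<^sub>1 @ x \<in> V"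
    if "\<not> prefix (?zs T @ ?zs (T + 2)) x" for x
  proof -
    have "?L (B + t - 1 - j) = ?L (B + t - j)" if "j < T + (T + 2)" for j
      using that L\<^sub>1[of j] L\<^sub>1[of "Suc j"] by (simp add: t_def)
    moreover have "?zs T @ ?zs (T + 2) = ?zs (T + (T + 2))"
      by (rule zs_add)
    ultimately show ?thesis
      unfolding a\<^sub>1V a\<^sub>2V using that reach_iso[of "T + (T + 2)" ?L "B + t - 1" "B + t" x \<delta>]
      by (simp add: t_def)
  qed
  have iso\<^sub>3: "a\<^sub>3 @ x \<in> V \<longleftrightarrow> a\<^sub>1 @ x \<in> V"
    if "\<not> prefix (?zs T @ ?zs (T + 2)) x" for x
  proof -
    have "?L (s - j) = ?L (B + t - j)" if "j < T + (T + 2)" for j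
      using that L\<^sub>1[of j] L\<^sub>3[of j] by (simp add: t_def)
    moreover have "?zs T @ ?zs (T + 2) = ?zs (T + (T + 2))"
      by (rule zs_add)
    ultimately show ?thesis
      unfolding a\<^sub>1V a\<^sub>3V using that reach_iso[of "T + (T + 2)" ?L s "B + t" x \<delta>] s
      by (simp add: t_def)
  qed

  let ?D = "region V z q (T + 1)" and ?R = "\<lambda>a. region V a (?zs T) (T + 1)"
  have prefix_m: "prefix (p @ ?zs m) x" if "prefix (p @ ?zs m') x" "m \<le> m'" for p m m' x
  proof -
    have "?zs m' = ?zs m @ ?zs (m' - m)"
      unfolding zs_add using that(2) by simp
    then show ?thesis
      using that(1) by (metis append.assoc append_prefixD)
  qed
  \<comment> \<open>The region is cut at depth \<open>2 * T + 1\<close> on the stem, at or above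
    \<open>z\<close>, and so loses everything below \<open>z\<close>.\<close>
  have stem_disjoint: "?D \<inter> ?R (?zs m) = {}" if "m + (2 * T + 1) \<le> N - (B + T)" for m
  proof (rule ccontr)
    assume "?D \<inter> ?R (?zs m) \<noteq> {}"
    then obtain w where "w \<in> ?D" "w \<in> ?R (?zs m)"
      by blast
    then obtain x x' where w: "w = ?zs m @ x" "w = z @ x'"
      and x: "\<not> prefix (?zs T @ ?zs (T + 1)) x"
      unfolding region_def by blast
    then have eq: "?zs m @ x = z @ x'"
      by simp
    define m' where "m' = N - (B + T) - m - (2 * T + 1)"
    have "z = ?zs m @ ?zs T @ ?zs (T + 1) @ ?zs m'"
      unfolding zs_add z_def using that by (intro arg_cong[of _ _ ?zs]) (simp add: m'_def)
    then have "x = (?zs T @ ?zs (T + 1)) @ (?zs m' @ x')"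
      using eq by simp
    then show False
      using x by (metis prefixI)
  qed
  have D\<^sub>1: "?D \<inter> ?R a\<^sub>1 = {}" and D\<^sub>2: "?D \<inter> ?R a\<^sub>2 = {}"
    unfolding a\<^sub>1_def a\<^sub>2_def using BN by (intro stem_disjoint; simp add: t_def)+
  \<comment> \<open>The node \<open>a\<^sub>3\<close> lies \<open>e \<ge> T + 1\<close> levels below
    \<open>v\<close> on the leftmost path, in the part cut off from the region of
    \<open>v\<close>.\<close>
  have D\<^sub>3: "?D \<inter> ?R a\<^sub>3 = {}"
  proof (rule ccontr)
    assume "?D \<inter> ?R a\<^sub>3 \<noteq> {}"
    then obtain w where "w \<in> ?D" "w \<in> ?R a\<^sub>3"
      by blast
    then obtain x x' where w: "w = a\<^sub>3 @ x" "w = z @ x'" and x: "\<not> prefix (q @ ?zs (T + 1)) x'"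
      unfolding region_def by blast
    then have eq: "a\<^sub>3 @ x = z @ x'"
      by simp
    have "x' = (q @ ?zs e) @ x"
      using eq by (simp add: a\<^sub>3_def vz)
    then show False
      using x prefix_m[of q e x' "T + 1"] e by simp
  qed
  have DV: "?D \<subseteq> V"
    by (auto simp: region_def)
  have iso_weaken: "\<not> prefix (?zs T @ ?zs (T + 2)) x" if "\<not> prefix (?zs T @ ?zs (T + 1)) x" for x
    using that prefix_m[of "?zs T" "T + 2" x "T + 1"] by auto
  obtain \<pi>\<^sub>2 where \<pi>\<^sub>2: "\<pi>\<^sub>2 permutes V" "\<And>w. w \<in> ?D \<Longrightarrow> \<pi>\<^sub>2 w = w"
    "\<And>x. a\<^sub>2 @ x \<in> ?R a\<^sub>2 \<Longrightarrow> \<pi>\<^sub>2 (a\<^sub>2 @ x) = a\<^sub>1 @ x"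
    using region_transfer_permutes[OF fin DV D\<^sub>2 D\<^sub>1 iso\<^sub>2[OF iso_weaken]] by blast
  obtain \<pi>\<^sub>3 where \<pi>\<^sub>3: "\<pi>\<^sub>3 permutes V" "\<And>w. w \<in> ?D \<Longrightarrow> \<pi>\<^sub>3 w = w"
    "\<And>x. a\<^sub>3 @ x \<in> ?R a\<^sub>3 \<Longrightarrow> \<pi>\<^sub>3 (a\<^sub>3 @ x) = a\<^sub>1 @ x"
    using region_transfer_permutes[OF fin DV D\<^sub>3 D\<^sub>1 iso\<^sub>3[OF iso_weaken]] by blast

  have nonroot: "z \<noteq> []" "a\<^sub>1 \<noteq> []" "a\<^sub>2 \<noteq> []" "a\<^sub>3 \<noteq> []"
    using BN e by (auto simp: z_def a\<^sub>1_def a\<^sub>2_def a\<^sub>3_def t_def)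
  have V: "z @ q \<in> V" "a\<^sub>2 @ ?zs T \<in> V" "a\<^sub>3 @ ?zs T \<in> V"
  proof -
    show "z @ q \<in> V"
      using v good_nodes_subset[OF \<delta> N] by (auto simp: vz V_def)
    show "a\<^sub>2 @ ?zs T \<in> V"
      unfolding a\<^sub>2V by (subst reach_replicate[OF \<delta>]) (auto simp: t_def)
    show "a\<^sub>3 @ ?zs T \<in> V"
      unfolding a\<^sub>3V using s by (subst reach_replicate[OF \<delta>]) auto
  qed
  have fixed: "node_output A V (ident \<circ> \<pi>) (\<omega> \<circ> \<pi>) v = node_output A V ident \<omega> v"
    if "\<And>w. w \<in> ?D \<Longrightarrow> \<pi> w = w" "rounds A V (ident \<circ> \<pi>) (\<omega> \<circ> \<pi>) \<le> enat T"
    for A :: "('r, 'l) local_algorithm" and \<pi> ident \<omega>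
    unfolding vz using V(1) that nonroot by (intro node_output_transport[OF ft]) (auto simp: q_def)
  have moved\<^sub>2: "node_output A V (ident \<circ> \<pi>\<^sub>2) (\<omega> \<circ> \<pi>\<^sub>2) (a\<^sub>2 @ ?zs T) = node_output A V ident \<omega> (a\<^sub>1 @ ?zs T)"
    if "rounds A V (ident \<circ> \<pi>\<^sub>2) (\<omega> \<circ> \<pi>\<^sub>2) \<le> enat T"
    for A :: "('r, 'l) local_algorithm" and ident \<omega>
    using V(2) that nonroot \<pi>\<^sub>2(3) iso\<^sub>2 by (intro node_output_transport[OF ft]) auto
  have moved\<^sub>3: "node_output A V (ident \<circ> \<pi>\<^sub>3) (\<omega> \<circ> \<pi>\<^sub>3) (a\<^sub>3 @ ?zs T) = node_output A V ident \<omega> (a\<^sub>1 @ ?zs T)"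
    if "rounds A V (ident \<circ> \<pi>\<^sub>3) (\<omega> \<circ> \<pi>\<^sub>3) \<le> enat T"
    for A :: "('r, 'l) local_algorithm" and ident \<omega>
    using V(3) that nonroot \<pi>\<^sub>3(3) iso\<^sub>3 by (intro node_output_transport[OF ft]) auto

  \<comment> \<open>The path from \<open>a\<^sub>1\<close> to the lower copy. It ends in state
    \<open>s - T > i * t\<close>, so all states on it exceed \<open>i * t\<close> and
    \<open>good_nodes_child\<close> applies throughout.\<close>
  define Y where "Y = ?zs t @ y @ ?zs (e + T)"
  have vY: "v @ ?zs (e + T) = a\<^sub>1 @ Y"
    using v_zs[of "N - (B + t)"] BN by (simp add: Y_def a\<^sub>1_def)
  have reach_Y: "reach \<delta> ?L (B + t) Y = Some (s - T)"
  proof -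
    have "reach \<delta> ?L (B + t) Y = reach \<delta> ?L h (?zs (e + T))"
      using y by (simp add: Y_def reach_zs reach_append[of _ _ _ y])
    also have "\<dots> = Some (s - T)"
      using e s by (subst reach_replicate[OF \<delta>]) auto
    finally show ?thesis .
  qed
  show ?thesis
  proof (rule that[of "a\<^sub>1 @ ?zs T" "?zs (t - T) @ y" "?zs (t - T - 1) @ y" "?zs (e + T)" \<pi>\<^sub>2 \<pi>\<^sub>3])
    show "v = (a\<^sub>1 @ ?zs T) @ ?zs (t - T) @ y"
      using v_zs[of "N - (B + t)"] BN by (simp add: a\<^sub>1_def t_def flip: append_assoc replicate_add)
    have a\<^sub>2: "(a\<^sub>1 @ ?zs T) @ [0] = a\<^sub>2 @ ?zs T"
      by (simp add: a\<^sub>1_def a\<^sub>2_def replicate_append_same flip: replicate_add)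
    show "v = ((a\<^sub>1 @ ?zs T) @ [0]) @ ?zs (t - T - 1) @ y"
    proof -
      have "(a\<^sub>2 @ ?zs T) @ ?zs (t - T - 1) = ?zs (N - B)"
        unfolding a\<^sub>2_def zs_add using BN by (intro arg_cong[of _ _ ?zs]) (simp add: t_def)
      then show ?thesis
        unfolding a\<^sub>2 y(1) by (simp only: append_assoc[symmetric])
    qed
    show "?zs (e + T) \<noteq> []"
      using e by simp
    have a\<^sub>3: "v @ ?zs (e + T) = a\<^sub>3 @ ?zs T"
      by (simp add: a\<^sub>3_def replicate_add)
    then show "v @ ?zs (e + T) \<in> V"
      using V by simp
    have "length Y \<le> B + t"
      using reach_length_le[OF light_less reach_Y] by simp
    also have "\<dots> \<le> (2 * k + 1) * t"
      unfolding B(2)[symmetric] by (intro mult_le_mono1) simp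
    finally show "length (v @ ?zs (e + T)) \<le> length (a\<^sub>1 @ ?zs T) + (2 * k + 1) * t"
      unfolding vY by simp
    show "w \<in> good_nodes \<delta> k t N i \<and> (\<forall>c<\<delta>. w @ [c] \<in> good_nodes \<delta> k t N i)"
      if w: "prefix (a\<^sub>1 @ ?zs T) w" "strict_prefix w (v @ ?zs (e + T))" for w
    proof -
      obtain x where x: "w = a\<^sub>1 @ x" "prefix x Y"
        using w unfolding vY by (auto simp: prefix_def strict_prefix_def)
      obtain h' where h': "reach \<delta> ?L (B + t) x = Some h'" "s - T + (length Y - length x) \<le> h'"
        by (rule reach_prefix[OF light_less reach_Y x(2)])
      have "i * t < h'"
        using h'(2) s by linarith
      have "w \<in> good_nodes \<delta> k t N i"
        unfolding x(1) good_nodes_def B a\<^sub>1_def using h'(1) \<open>i * t < h'\<close> by fastforce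
      moreover have "w @ [c] \<in> good_nodes \<delta> k t N i" if "c < \<delta>" for c
        using good_nodes_child[OF less_imp_le[OF i], of \<delta> t, unfolded B, OF h'(1) \<open>i * t < h'\<close> that, of N]
        unfolding x(1) a\<^sub>1_def .
      ultimately show ?thesis
        by blast
    qed
    show "node_output A V (ident \<circ> \<pi>\<^sub>2) (\<omega> \<circ> \<pi>\<^sub>2) v = node_output A V ident \<omega> v \<and>
      node_output A V (ident \<circ> \<pi>\<^sub>2) (\<omega> \<circ> \<pi>\<^sub>2) ((a\<^sub>1 @ ?zs T) @ [0]) = node_output A V ident \<omega> (a\<^sub>1 @ ?zs T)"
      if "rounds A V (ident \<circ> \<pi>\<^sub>2) (\<omega> \<circ> \<pi>\<^sub>2) \<le> enat T"
      for A :: "('r, 'l) local_algorithm" and ident \<omega>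
      using fixed[OF \<pi>\<^sub>2(2) that] moved\<^sub>2[OF that] unfolding a\<^sub>2 by blast
    show "node_output A V (ident \<circ> \<pi>\<^sub>3) (\<omega> \<circ> \<pi>\<^sub>3) v = node_output A V ident \<omega> v \<and>
      node_output A V (ident \<circ> \<pi>\<^sub>3) (\<omega> \<circ> \<pi>\<^sub>3) (v @ ?zs (e + T)) = node_output A V ident \<omega> (a\<^sub>1 @ ?zs T)"
      if "rounds A V (ident \<circ> \<pi>\<^sub>3) (\<omega> \<circ> \<pi>\<^sub>3) \<le> enat T"
      for A :: "('r, 'l) local_algorithm" and ident \<omega>
      using fixed[OF \<pi>\<^sub>3(2) that] moved\<^sub>3[OF that] unfolding a\<^sub>3 by blast
  qed fact+
qed

section \<open>Failure probabilities\<close>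

lemma prob_space_random_bits: "prob_space (random_bits V)"
  unfolding random_bits_def
  by (intro prob_space_PiM prob_space.prob_space_stream_space measure_pmf.prob_space_axioms)

text \<open>All factors of the product measure are equal, so reindexing by a permutation preserves
  it.\<close>

lemma random_bits_permute:
  assumes \<pi>: "\<pi> permutes V" and X: "X \<in> sets (random_bits V)"
  shows "{\<omega> \<in> space (random_bits V). \<omega> \<circ> \<pi> \<in> X} \<in> sets (random_bits V)"
    and "measure (random_bits V) {\<omega> \<in> space (random_bits V). \<omega> \<circ> \<pi> \<in> X} = measure (random_bits V) X"
proof -
  let ?M = "random_bits V" and ?f = "\<lambda>\<omega>. \<lambda>v\<in>V. \<omega> (\<pi> v)"
  \<comment> \<open>Points of the product space are \<open>undefined\<close> outside
    \<open>V\<close>, and \<pi> fixes all indices there.\<close>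
  have eq: "\<omega> \<circ> \<pi> = ?f \<omega>" if "\<omega> \<in> space ?M" for \<omega>
  proof
    fix v
    show "(\<omega> \<circ> \<pi>) v = ?f \<omega> v"
      using that \<pi> by (cases "v \<in> V")
        (auto simp: random_bits_def space_PiM PiE_def extensional_def permutes_def)
  qed
  have f: "?f \<in> measurable ?M ?M"
    unfolding random_bits_def using permutes_in_image[OF \<pi>]
    by (intro measurable_restrict measurable_component_singleton) auto
  have distr: "distr ?M ?M ?f = ?M"
    unfolding random_bits_def
    using permutes_in_image[OF \<pi>] permutes_inj_on[OF \<pi>]
    by (intro distr_PiM_reindex prob_space.prob_space_stream_space measure_pmf.prob_space_axioms) auto
  have vimage: "{\<omega> \<in> space ?M. \<omega> \<circ> \<pi> \<in> X} = ?f -` X \<inter> space ?M"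
    using eq by auto
  show "{\<omega> \<in> space ?M. \<omega> \<circ> \<pi> \<in> X} \<in> sets ?M"
    unfolding vimage using f X by (rule measurable_sets)
  have "measure ?M X = measure (distr ?M ?M ?f) X"
    by (simp only: distr)
  also have "\<dots> = measure ?M (?f -` X \<inter> space ?M)"
    using f X by (rule measure_distr)
  finally show "measure ?M {\<omega> \<in> space ?M. \<omega> \<circ> \<pi> \<in> X} = measure ?M X"
    unfolding vimage by simp
qed

lemma comp_permutes_in_space:
  assumes "\<pi> permutes V" "\<omega> \<in> space (random_bits V)"
  shows "\<omega> \<circ> \<pi> \<in> space (random_bits V)"
  using assms permutes_in_image[OF assms(1)]
  by (fastforce simp: random_bits_def space_PiM PiE_def Pi_def extensional_def permutes_def)

text \<open>An error anywhere in the tree counts, so that outside the event a whole solution is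
  available for reading off walks. Once no labels are left, the event is the whole space.\<close>

definition failure ::
  "'l lcl \<Rightarrow> node set \<Rightarrow> (bool stream, 'l) local_algorithm \<Rightarrow> nat \<Rightarrow> (node \<Rightarrow> nat) \<Rightarrow> node \<Rightarrow>
    (node \<Rightarrow> bool stream) set"
where
  "failure P V A i ident v = {\<omega> \<in> space (random_bits V).
     \<not> (correct_output P V (node_output A V ident \<omega>) \<and>
        node_output A V ident \<omega> v \<in> Some ` labels (flexible_restriction P i))}"

lemma correct_output_label:
  assumes "correct_output P V out"
  obtains lab where "is_solution P V lab" "\<And>v. v \<in> V \<Longrightarrow> out v = Some (lab v)"
  using assms unfolding correct_output_def by blast

context
  fixes P :: "'l lcl" and p :: "nat \<Rightarrow> nat" and A :: "(bool stream, 'l) local_algorithm"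
    and k T N :: nat
  fixes V t
  assumes P: "lcl_problem P" and A: "rand_solves p P A"
    and N: "(2 * k + 1) * t < N" and t: "t = 3 * T + 3"
    and V: "V = hard_tree (arity P) k t N"
    and T: "\<And>ident \<omega>. (V, ident) \<in> instances p (arity P) \<Longrightarrow>
      \<omega> \<in> space (random_bits V) \<Longrightarrow> rounds A V ident \<omega> \<le> enat T"
begin

lemma lcl_arity_pos: "0 < arity P"
  using P by (simp add: lcl_problem_def)

lemma full_tree_instance: "full_tree (arity P) V"
  unfolding V by (rule full_tree_state_tree[OF light_less])

lemma good_nodes_in_tree: "good_nodes (arity P) k t N i \<subseteq> V"
  unfolding V using lcl_arity_pos N by (rule good_nodes_subset)

lemma card_ge_2: "2 \<le> card V"
proof -
  have fin: "finite V" and root: "[] \<in> V"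
    using full_tree_instance by (auto simp: full_tree_def)
  have "[0] \<in> V"
    using N lcl_arity_pos by (auto simp: V state_tree_def)
  then have "card {[], [0::nat]} \<le> card V"
    using fin root by (intro card_mono) auto
  then show ?thesis
    by simp
qed

lemma instance_permute:
  assumes "(V, ident) \<in> instances p (arity P)" "\<pi> permutes V"
  shows "(V, ident \<circ> \<pi>) \<in> instances p (arity P)"
  using assms permutes_inj_on[OF assms(2)] permutes_image[OF assms(2)]
  by (auto simp: instances_def comp_inj_on image_comp[symmetric])

text \<open>Measurability of the event of a correct output comes for free: the \<open>measure\<close> of a
  non-measurable set is \<open>0\<close>, which is below the required success probability.\<close>

lemma sets_failure:
  assumes I: "(V, ident) \<in> instances p (arity P)" and v: "v \<in> V"
  shows "failure P V A i ident v \<in> sets (random_bits V)"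
proof -
  let ?M = "random_bits V"
  have "measure ?M {\<omega> \<in> space ?M. correct_output P V (node_output A V ident \<omega>)} \<noteq> 0"
  proof -
    have "1 / real (card V) < 1"
      using card_ge_2 by simp
    then show ?thesis
      using A I unfolding rand_solves_def by fastforce
  qed
  then have "{\<omega> \<in> space ?M. correct_output P V (node_output A V ident \<omega>)} \<in> sets ?M"
    using measure_notin_sets by blast
  moreover have "(\<lambda>\<omega>. node_output A V ident \<omega> v) -` (Some ` labels (flexible_restriction P i)) \<inter> space ?M
      \<in> sets ?M"
    using A I v unfolding rand_solves_def by (intro measurable_sets[where A = "count_space UNIV"]) auto
  ultimately have "space ?M -
      ({\<omega> \<in> space ?M. correct_output P V (node_output A V ident \<omega>)} \<inter>
       ((\<lambda>\<omega>. node_output A V ident \<omega> v) -` (Some ` labels (flexible_restriction P i)) \<inter> space ?M)) \<in> sets ?M"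
    by blast
  also have "space ?M -
      ({\<omega> \<in> space ?M. correct_output P V (node_output A V ident \<omega>)} \<inter>
       ((\<lambda>\<omega>. node_output A V ident \<omega> v) -` (Some ` labels (flexible_restriction P i)) \<inter> space ?M)) =
      failure P V A i ident v"
    by (auto simp: failure_def)
  finally show ?thesis .
qed

lemma measure_failure_0:
  assumes I: "(V, ident) \<in> instances p (arity P)" and v: "v \<in> V"
  shows "measure (random_bits V) (failure P V A 0 ident v) \<le> 1 / real (card V)"
proof -
  interpret prob_space "random_bits V"
    by (rule prob_space_random_bits)
  let ?S = "{\<omega> \<in> space (random_bits V). correct_output P V (node_output A V ident \<omega>)}"
  have "failure P V A 0 ident v = space (random_bits V) - ?S"
    using v by (fastforce simp: failure_def is_solution_def elim: correct_output_label)
  moreover from this have "?S \<in> sets (random_bits V)"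
    using sets_failure[OF I v, of 0] by (metis (no_types, lifting) double_diff mem_Collect_eq
        sets.compl_sets subsetI)
  moreover have "1 - 1 / real (card V) \<le> prob ?S"
    using A I unfolding rand_solves_def by fast
  ultimately show ?thesis
    by (simp add: prob_compl)
qed

text \<open>The three walks come from different labelings, but all live in the same automaton and
  share the end labels \<open>a\<close> and \<open>b\<close>, so they can be concatenated.\<close>

lemma flexible_output:
  assumes i: "i < k"
    and v: "v = u\<^sub>1 @ y\<^sub>1" "v = (u\<^sub>1 @ [0]) @ y\<^sub>2" "y\<^sub>3 \<noteq> []" "v @ y\<^sub>3 \<in> V"
    and ok: "\<And>out w. out \<in> {out\<^sub>1, out\<^sub>2, out\<^sub>3} \<Longrightarrow> prefix u\<^sub>1 w \<Longrightarrow> strict_prefix w (v @ y\<^sub>3) \<Longrightarrow>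
      correct_output P V out \<and> out w \<in> Some ` labels (flexible_restriction P i) \<and>
      (\<forall>c<arity P. out (w @ [c]) \<in> Some ` labels (flexible_restriction P i))"
    and eq: "out\<^sub>2 v = out\<^sub>1 v" "out\<^sub>2 (u\<^sub>1 @ [0]) = out\<^sub>1 u\<^sub>1" "out\<^sub>3 v = out\<^sub>1 v" "out\<^sub>3 (v @ y\<^sub>3) = out\<^sub>1 u\<^sub>1"
  shows "out\<^sub>1 v \<in> Some ` labels (flexible_restriction P (Suc i))"
proof -
  let ?R = "automaton (flexible_restriction P i)"
  have walk: "(a, b) \<in> ?R ^^ length y"
    if out: "out \<in> {out\<^sub>1, out\<^sub>2, out\<^sub>3}" and xy: "prefix u\<^sub>1 x" "prefix (x @ y) (v @ y\<^sub>3)"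
      and ab: "out x = Some a" "out (x @ y) = Some b"
    for out x y a b
  proof -
    have "strict_prefix u\<^sub>1 (v @ y\<^sub>3)"
      using v by (auto simp: strict_prefix_def)
    then have "correct_output P V out"
      using ok[OF out, of u\<^sub>1] by simp
    then obtain lab where sol: "is_solution P V lab" and lab: "\<And>v. v \<in> V \<Longrightarrow> out v = Some (lab v)"
      unfolding correct_output_def by blast
    have closed: "w \<in> V" if "w @ z \<in> V" for w z
      using that
    proof (induction z rule: rev_induct)
      case (snoc c z)
      then show ?case
        using full_tree_instance unfolding full_tree_def by (metis append.assoc)
    qed simp
    have V_xy: "x @ y \<in> V" "x \<in> V"
      using v(4) xy closed by (metis prefixE)+
    have "(lab x, lab (x @ y)) \<in> ?R ^^ length y"
    proof (rule solution_walk[OF P full_tree_instance sol V_xy(1)])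
      fix w assume w: "prefix x w" "strict_prefix w (x @ y)"
      then have "prefix u\<^sub>1 w" "strict_prefix w (v @ y\<^sub>3)"
        using xy by (meson prefix_order.order_trans prefix_order.less_le_trans)+
      note okw = ok[OF out this]
      have "w \<in> V"
        using w closed V_xy by (metis prefixE strict_prefix_def)
      show "lab w \<in> labels (flexible_restriction P i) \<and>
          (\<forall>c. w @ [c] \<in> V \<longrightarrow> lab (w @ [c]) \<in> labels (flexible_restriction P i))"
      proof (intro conjI allI impI)
        show "lab w \<in> labels (flexible_restriction P i)"
          using okw lab[OF \<open>w \<in> V\<close>] by auto
        fix c assume c: "w @ [c] \<in> V"
        then have "c < arity P"
          using full_tree_instance \<open>w \<in> V\<close> unfolding full_tree_def by blast
        then show "lab (w @ [c]) \<in> labels (flexible_restriction P i)"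
          using okw lab[OF c] by auto
      qed
    qed
    then show ?thesis
      using lab V_xy ab by simp
  qed
  have pv: "prefix u\<^sub>1 v" "strict_prefix v (v @ y\<^sub>3)" "prefix u\<^sub>1 (u\<^sub>1 @ [0])"
    "prefix u\<^sub>1 u\<^sub>1" "strict_prefix u\<^sub>1 (v @ y\<^sub>3)"
    using v by (auto simp: strict_prefix_def)
  obtain a where a: "out\<^sub>1 v = Some a" "a \<in> labels (flexible_restriction P i)"
    using ok[of out\<^sub>1 v] pv by auto
  obtain b where b: "out\<^sub>1 u\<^sub>1 = Some b"
    using ok[of out\<^sub>1 u\<^sub>1] pv by auto
  have "(b, a) \<in> ?R ^^ length y\<^sub>1"
    using a b v(1) pv by (intro walk[of out\<^sub>1 u\<^sub>1 y\<^sub>1]) auto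
  moreover have "length y\<^sub>1 = Suc (length y\<^sub>2)"
    using v(1,2) by auto
  moreover have "(b, a) \<in> ?R ^^ length y\<^sub>2"
    using a b v(2) pv eq by (intro walk[of out\<^sub>2 "u\<^sub>1 @ [0]" y\<^sub>2]) (auto simp flip: v(2))
  moreover have "(a, b) \<in> ?R ^^ length y\<^sub>3"
    using a b pv eq by (intro walk[of out\<^sub>3 v y\<^sub>3]) auto
  ultimately have "(a, a) \<in> ?R ^^ (length y\<^sub>3 + length y\<^sub>2)"
    and "(a, a) \<in> ?R ^^ (length y\<^sub>3 + Suc (length y\<^sub>2))"
    unfolding relpow_add by (metis relcompI)+
  then have "path_flexible (flexible_restriction P i) a"
    by (intro path_flexibleI) simp_all
  then show ?thesis
    unfolding labels_flexible_restriction_Suc using a by blast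
qed

text \<open>The factor counts three runs, at most \<open>(2 * k + 1) * t\<close> path nodes, and
  each of these together with its children. \<open>IH\<close> ranges over all identifiers because
  two of the runs permute them.\<close>

lemma measure_failure_Suc:
  assumes i: "i < k" and v: "v \<in> good_nodes (arity P) k t N (Suc i)"
    and I: "(V, ident) \<in> instances p (arity P)"
    and IH: "\<And>ident w. (V, ident) \<in> instances p (arity P) \<Longrightarrow> w \<in> good_nodes (arity P) k t N i \<Longrightarrow>
      measure (random_bits V) (failure P V A i ident w) \<le> q"
  shows "measure (random_bits V) (failure P V A (Suc i) ident v)
    \<le> real (3 * ((2 * k + 1) * t * (arity P + 1))) * q"
proof -
  let ?\<delta> = "arity P" and ?M = "random_bits V"
  interpret prob_space ?M
    by (rule prob_space_random_bits)
  obtain u y\<^sub>1 y\<^sub>2 y\<^sub>3 \<pi>\<^sub>2 \<pi>\<^sub>3 where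
    y: "v = u @ y\<^sub>1" "v = (u @ [0]) @ y\<^sub>2" "y\<^sub>3 \<noteq> []" "v @ y\<^sub>3 \<in> V"
    and \<pi>: "\<pi>\<^sub>2 permutes V" "\<pi>\<^sub>3 permutes V"
    and len: "length (v @ y\<^sub>3) \<le> length u + (2 * k + 1) * t"
    and good: "\<And>w. prefix u w \<Longrightarrow> strict_prefix w (v @ y\<^sub>3) \<Longrightarrow>
      w \<in> good_nodes ?\<delta> k t N i \<and> (\<forall>c<?\<delta>. w @ [c] \<in> good_nodes ?\<delta> k t N i)"
    and out: "\<And>(A :: (bool stream, 'l) local_algorithm) ident \<omega>.
      rounds A V (ident \<circ> \<pi>\<^sub>2) (\<omega> \<circ> \<pi>\<^sub>2) \<le> enat T \<Longrightarrow>
      node_output A V (ident \<circ> \<pi>\<^sub>2) (\<omega> \<circ> \<pi>\<^sub>2) v = node_output A V ident \<omega> v \<and>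
      node_output A V (ident \<circ> \<pi>\<^sub>2) (\<omega> \<circ> \<pi>\<^sub>2) (u @ [0]) = node_output A V ident \<omega> u"
      "\<And>(A :: (bool stream, 'l) local_algorithm) ident \<omega>.
      rounds A V (ident \<circ> \<pi>\<^sub>3) (\<omega> \<circ> \<pi>\<^sub>3) \<le> enat T \<Longrightarrow>
      node_output A V (ident \<circ> \<pi>\<^sub>3) (\<omega> \<circ> \<pi>\<^sub>3) v = node_output A V ident \<omega> v \<and>
      node_output A V (ident \<circ> \<pi>\<^sub>3) (\<omega> \<circ> \<pi>\<^sub>3) (v @ y\<^sub>3) = node_output A V ident \<omega> u"
    by (rule transplant[OF lcl_arity_pos N[unfolded t] i v[unfolded t], folded t V]) blast
  define m where "m = length (v @ y\<^sub>3) - length u"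
  \<comment> \<open>The index \<open>c = \<delta>\<close> stands for the path node itself, the
    smaller ones for its children.\<close>
  define W where "W = (\<lambda>(j, c). take (length u + j) (v @ y\<^sub>3) @ (if c < ?\<delta> then [c] else []))
    ` ({..<m} \<times> {..?\<delta>})"
  define E where "E = {id, \<pi>\<^sub>2, \<pi>\<^sub>3}"
  \<comment> \<open>The failure of the permuted run, pulled back to the original bits so that all
    events live on one outcome \<omega>.\<close>
  define F where "F = (\<lambda>(\<pi>, w). {\<omega> \<in> space ?M. \<omega> \<circ> \<pi> \<in> failure P V A i (ident \<circ> \<pi>) w})"
  have E: "\<pi> permutes V" if "\<pi> \<in> E" for \<pi>
    using that \<pi> permutes_id by (auto simp: E_def)
  have W_good: "W \<subseteq> good_nodes ?\<delta> k t N i"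
  proof
    fix w assume "w \<in> W"
    then obtain j c where j: "j < m" and w: "w = take (length u + j) (v @ y\<^sub>3) @ (if c < ?\<delta> then [c] else [])"
      by (auto simp: W_def)
    have "prefix u (take (length u + j) (v @ y\<^sub>3))"
      using y(1) by simp
    moreover have "take (length u + j) (v @ y\<^sub>3) \<noteq> v @ y\<^sub>3"
    proof
      assume "take (length u + j) (v @ y\<^sub>3) = v @ y\<^sub>3"
      then have "length (take (length u + j) (v @ y\<^sub>3)) = length (v @ y\<^sub>3)"
        by simp
      then show False
        using j unfolding m_def by simp
    qed
    then have "strict_prefix (take (length u + j) (v @ y\<^sub>3)) (v @ y\<^sub>3)"
      unfolding strict_prefix_def using take_is_prefix by blast
    ultimately have "take (length u + j) (v @ y\<^sub>3) \<in> good_nodes ?\<delta> k t N i \<and>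
        (\<forall>c<?\<delta>. take (length u + j) (v @ y\<^sub>3) @ [c] \<in> good_nodes ?\<delta> k t N i)"
      by (rule good)
    then show "w \<in> good_nodes ?\<delta> k t N i"
      unfolding w by (cases "c < ?\<delta>") (simp_all del: take_append append_assoc)
  qed
  have W_path: "w \<in> W" "c < ?\<delta> \<Longrightarrow> w @ [c] \<in> W"
    if pre: "prefix u w" "strict_prefix w (v @ y\<^sub>3)" for w c
  proof -
    obtain z where z: "v @ y\<^sub>3 = w @ z"
      using pre(2) by (auto simp: strict_prefix_def prefix_def)
    have w: "take (length u + (length w - length u)) (v @ y\<^sub>3) = w"
      unfolding z using prefix_length_le[OF pre(1)] by simp
    have "length w - length u < m"
      using prefix_length_le[OF pre(1)] prefix_length_less[OF pre(2)] by (simp add: m_def)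
    then have "w @ (if c < ?\<delta> then [c] else []) \<in> W" if "c \<le> ?\<delta>" for c
      unfolding W_def using that
      by (intro image_eqI[where x = "(length w - length u, c)"]) (simp_all only: w split, auto)
    from this[of ?\<delta>] this[of c] show "w \<in> W" "c < ?\<delta> \<Longrightarrow> w @ [c] \<in> W"
      by auto
  qed
  have "failure P V A (Suc i) ident v \<subseteq> (\<Union>x\<in>E \<times> W. F x)"
  proof (rule ccontr)
    assume "\<not> failure P V A (Suc i) ident v \<subseteq> (\<Union>x\<in>E \<times> W. F x)"
    then obtain \<omega> where \<omega>: "\<omega> \<in> failure P V A (Suc i) ident v"
      and not_F: "\<And>\<pi> w. \<pi> \<in> E \<Longrightarrow> w \<in> W \<Longrightarrow> \<omega> \<notin> F (\<pi>, w)"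
      by blast
    then have \<omega>M: "\<omega> \<in> space ?M"
      by (simp add: failure_def)
    define out where "out = (\<lambda>\<pi>. node_output A V (ident \<circ> \<pi>) (\<omega> \<circ> \<pi>))"
    have ok: "correct_output P V (out \<pi>) \<and> out \<pi> w \<in> Some ` labels (flexible_restriction P i)"
      if "\<pi> \<in> E" "w \<in> W" for \<pi> w
      using not_F[OF that] \<omega>M comp_permutes_in_space[OF E[OF that(1)] \<omega>M]
      by (auto simp: F_def failure_def out_def)
    have rounds: "rounds A V (ident \<circ> \<pi>) (\<omega> \<circ> \<pi>) \<le> enat T" if "\<pi> \<in> E" for \<pi>
      using that E \<omega>M by (intro T instance_permute comp_permutes_in_space I) auto
    have "out id v \<in> Some ` labels (flexible_restriction P (Suc i))"
    proof (rule flexible_output[OF i y])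
      show "correct_output P V f \<and> f w \<in> Some ` labels (flexible_restriction P i) \<and>
          (\<forall>c<?\<delta>. f (w @ [c]) \<in> Some ` labels (flexible_restriction P i))"
        if f: "f \<in> {out id, out \<pi>\<^sub>2, out \<pi>\<^sub>3}" and w: "prefix u w" "strict_prefix w (v @ y\<^sub>3)" for f w
      proof -
        obtain \<pi> where "\<pi> \<in> E" "f = out \<pi>"
          using f by (auto simp: E_def)
        then show ?thesis
          using ok W_path[OF w] by blast
      qed
      show "out \<pi>\<^sub>2 v = out id v" "out \<pi>\<^sub>2 (u @ [0]) = out id u"
        using out(1)[OF rounds[of \<pi>\<^sub>2]] by (simp_all add: out_def E_def)
      show "out \<pi>\<^sub>3 v = out id v" "out \<pi>\<^sub>3 (v @ y\<^sub>3) = out id u"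
        using out(2)[OF rounds[of \<pi>\<^sub>3]] by (simp_all add: out_def E_def)
    qed
    moreover have "correct_output P V (out id)"
      using ok[of id u] W_path[of u] y by (simp add: E_def strict_prefix_def)
    ultimately show False
      using \<omega> by (simp add: failure_def out_def)
  qed
  moreover have finite: "finite (E \<times> W)"
    by (simp add: E_def W_def)
  have F: "F x \<in> sets ?M" "prob (F x) \<le> q" if x_EW: "x \<in> E \<times> W" for x
  proof -
    obtain \<pi> w where x: "x = (\<pi>, w)" "\<pi> \<in> E" "w \<in> W"
      using x_EW by blast
    note I' = instance_permute[OF I E[OF x(2)]]
    have w: "w \<in> good_nodes ?\<delta> k t N i"
      using W_good x by blast
    then have "failure P V A i (ident \<circ> \<pi>) w \<in> sets ?M"
      using sets_failure[OF I'] good_nodes_in_tree by blast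
    note random_bits_permute[OF E[OF x(2)] this]
    then show "F x \<in> sets ?M" "prob (F x) \<le> q"
      unfolding F_def x using IH[OF I' w] by simp_all
  qed
  ultimately have "prob (failure P V A (Suc i) ident v) \<le> prob (\<Union>x\<in>E \<times> W. F x)"
    by (intro finite_measure_mono sets.finite_UN finite) auto
  also have "\<dots> \<le> (\<Sum>x\<in>E \<times> W. prob (F x))"
    using finite F(1) by (intro measure_UNION_le) auto
  also have "\<dots> \<le> (\<Sum>x\<in>E \<times> W. q)"
    by (intro sum_mono F)
  also have "\<dots> = real (card E * card W) * q"
    by (simp add: card_cartesian_product)
  also have "\<dots> \<le> real (3 * ((2 * k + 1) * t * (?\<delta> + 1))) * q"
  proof (intro mult_right_mono of_nat_mono mult_le_mono)
    show "card E \<le> 3"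
      unfolding E_def by (simp add: card_insert_if)
    have "card W \<le> m * (?\<delta> + 1)"
      unfolding W_def by (rule order_trans[OF card_image_le]) (auto simp: card_cartesian_product)
    also have "\<dots> \<le> (2 * k + 1) * t * (?\<delta> + 1)"
      using len by (intro mult_le_mono1) (simp add: m_def)
    finally show "card W \<le> (2 * k + 1) * t * (?\<delta> + 1)" .
    \<comment> \<open>Monotonicity in the first factor needs \<open>0 \<le> q\<close>, which holds
      because \<open>q\<close> bounds a probability.\<close>
    have "u \<in> good_nodes ?\<delta> k t N i"
      using good[of u] y by (simp add: strict_prefix_def)
    then show "0 \<le> q"
      using IH[OF I] by (meson measure_nonneg order_trans)
  qed
  finally show ?thesis .
qed

lemma measure_failure:
  assumes "i \<le> k" "(V, ident) \<in> instances p (arity P)" "v \<in> good_nodes (arity P) k t N i"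
  shows "measure (random_bits V) (failure P V A i ident v)
    \<le> real (3 * ((2 * k + 1) * t * (arity P + 1))) ^ i / real (card V)"
  using assms
proof (induction i arbitrary: ident v)
  case 0
  then show ?case
    using measure_failure_0 good_nodes_in_tree by auto
next
  case (Suc i)
  have "measure (random_bits V) (failure P V A (Suc i) ident v) \<le>
    real (3 * ((2 * k + 1) * t * (arity P + 1))) *
    (real (3 * ((2 * k + 1) * t * (arity P + 1))) ^ i / real (card V))"
    using Suc.prems by (intro measure_failure_Suc Suc.IH) auto
  then show ?case
    by (simp add: mult.assoc)
qed

lemma card_le_of_no_labels:
  assumes "labels (flexible_restriction P k) = {}" and I: "(V, ident) \<in> instances p (arity P)"
  shows "card V \<le> (3 * ((2 * k + 1) * t * (arity P + 1))) ^ k"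
proof -
  interpret prob_space "random_bits V"
    by (rule prob_space_random_bits)
  have "k * t \<le> (2 * k + 1 - k) * t"
    by (intro mult_le_mono1) simp
  \<comment> \<open>A witness that the last set of good nodes is nonempty: its topmost node, in
    state \<open>(k + 1) * t\<close>.\<close>
  then have "replicate (N - (2 * k + 1 - k) * t) 0 @ [] \<in> good_nodes (arity P) k t N k"
    unfolding good_nodes_def by (intro CollectI exI conjI) auto
  then have "prob (failure P V A k ident (replicate (N - (2 * k + 1 - k) * t) 0 @ []))
      \<le> real (3 * ((2 * k + 1) * t * (arity P + 1))) ^ k / real (card V)"
    using I by (intro measure_failure) auto
  moreover have "failure P V A k ident v = space (random_bits V)" for v
    using assms by (auto simp: failure_def)
  ultimately have "1 \<le> real (3 * ((2 * k + 1) * t * (arity P + 1))) ^ k / real (card V)"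
    by (simp add: prob_space)
  then have "real (card V) \<le> real ((3 * ((2 * k + 1) * t * (arity P + 1))) ^ k)"
    using card_ge_2 by (simp add: field_simps)
  then show ?thesis
    unfolding of_nat_le_iff .
qed

end

section \<open>From failure probabilities to running times\<close>

lemma instance_exists:
  assumes "polynomial_id_range p" "full_tree \<delta> V"
  obtains ident where "(V, ident) \<in> instances p \<delta>"
proof -
  have "finite V"
    using assms by (simp add: full_tree_def)
  then obtain f where f: "bij_betw f V {0..<card V}"
    using ex_bij_betw_finite_nat by blast
  have "(Suc \<circ> f) ` V \<subseteq> {1..p (card V)}"
  proof -
    have "card V \<le> p (card V)"
      using assms by (simp add: polynomial_id_range_def)
    then show ?thesis
      using bij_betw_apply[OF f] by (fastforce simp: Suc_le_eq)
  qed
  moreover have "inj_on (Suc \<circ> f) V"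
    using f by (simp add: bij_betw_def comp_inj_on)
  ultimately show ?thesis
    using assms that[of "Suc \<circ> f"] by (auto simp: instances_def)
qed

text \<open>For \<open>t = 3 * T + 3\<close> the base of the power is the loss factor per level. The
  exponent \<open>k + 2\<close> matches the number of factors in the size bound of the hard tree,
  and it strictly exceeds the exponent \<open>k\<close> of the total loss.\<close>

lemma rand_time_lower_bound:
  assumes P: "lcl_problem P" and p: "polynomial_id_range p" and A: "rand_solves p P A"
    and no_labels: "labels (flexible_restriction P k) = {}" and n: "n \<in> tree_sizes (arity P)"
    and large: "(9 * (2 * k + 1) * (arity P + 1) * (T + 1)) ^ (k + 2) \<le> n"
  shows "enat T < rand_time p P A n"
proof (rule ccontr)
  assume "\<not> enat T < rand_time p P A n"
  then have le: "rand_time p P A n \<le> enat T"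
    by simp
  define t where "t = 3 * T + 3"
  let ?\<delta> = "arity P"
  let ?c = "9 * (2 * k + 1) * (?\<delta> + 1) * (T + 1)"
  have \<delta>: "0 < ?\<delta>"
    using P by (simp add: lcl_problem_def)
  have "(1 + t * ?\<delta>) ^ (k + 1) * (1 + (k * t + 1) * ?\<delta>) \<le> ?c ^ (k + 1) * ?c"
    by (intro mult_le_mono power_mono) (auto simp: t_def algebra_simps)
  also have "\<dots> = ?c ^ (k + 2)"
    by simp
  also have "\<dots> \<le> n"
    by (rule large)
  finally obtain N where N: "(2 * k + 1) * t < N" "card (hard_tree ?\<delta> k t N) = n"
    using hard_tree_of_size[OF n \<delta>, of t k] by (auto simp: t_def)
  define V where "V = hard_tree ?\<delta> k t N"
  have "full_tree ?\<delta> V"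
    unfolding V_def by (rule full_tree_state_tree[OF light_less])
  then obtain ident where I: "(V, ident) \<in> instances p ?\<delta>"
    using instance_exists[OF p] by blast
  \<comment> \<open>The worst case is over all identifiers and all bits, so the bound also holds for
    the permuted runs.\<close>
  have rounds: "rounds A V ident \<omega> \<le> enat T"
    if "(V, ident) \<in> instances p ?\<delta>" "\<omega> \<in> space (random_bits V)" for ident \<omega>
  proof -
    have "(V, ident) \<in> instances_of_size p ?\<delta> n"
      using that N by (simp add: instances_of_size_def V_def)
    then show ?thesis
      using bspec[OF le[unfolded rand_time_def SUP_le_iff]] that(2) by (fastforce simp: SUP_le_iff)
  qed
  have "n \<le> (3 * ((2 * k + 1) * t * (?\<delta> + 1))) ^ k"
    using card_le_of_no_labels[OF P A N(1) t_def V_def rounds no_labels I] N(2) by (simp add: V_def)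
  also have "3 * ((2 * k + 1) * t * (?\<delta> + 1)) = ?c"
    by (simp add: t_def algebra_simps)
  also have "?c ^ k < ?c ^ (k + 2)"
    by (intro power_strict_increasing) auto
  also have "\<dots> \<le> n"
    by (rule large)
  finally show False
    by simp
qed

section \<open>Lower bounds on the complexities\<close>

lemma complexity_Omega_mono:
  assumes "complexity_Omega \<delta> f g" "\<And>n. f n \<le> f' n"
  shows "complexity_Omega \<delta> f' g"
proof -
  obtain c where "c > 0" and c: "\<forall>\<^sub>F n in sequentially. n \<in> tree_sizes \<delta> \<longrightarrow> ereal (c * g n) \<le> ereal_of_enat (f n)"
    using assms(1) unfolding complexity_Omega_def by blast
  have "ereal_of_enat (f n) \<le> ereal_of_enat (f' n)" for n
    using assms(2) by simp
  then have "\<forall>\<^sub>F n in sequentially. n \<in> tree_sizes \<delta> \<longrightarrow> ereal (c * g n) \<le> ereal_of_enat (f' n)"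
    using c by (auto elim!: eventually_mono intro: order_trans)
  then show ?thesis
    unfolding complexity_Omega_def using \<open>c > 0\<close> by blast
qed

lemma rand_complexity_le_det_complexity:
  assumes "lcl_problem P"
  shows "rand_complexity p P n \<le> det_complexity p P n"
  unfolding det_complexity_def
proof (rule INF_greatest)
  fix A assume "A \<in> {A. det_solves p P A}"
  then have A: "det_solves p P A"
    by simp
  define A' where "A' = \<lparr>alg_init = \<lambda>x (_ :: bool stream). alg_init A x (), alg_send = alg_send A,
    alg_receive = alg_receive A, alg_output = alg_output A\<rparr>"
  have out: "alg_output A' = alg_output A"
    by (simp add: A'_def)
  have state: "state_after A' V ident \<omega> s = state_after A V ident (\<lambda>_. ()) s" for V ident \<omega> s
    by (induction s) (simp_all add: A'_def)
  then have has_output: "has_output_at A' V ident \<omega> = has_output_at A V ident (\<lambda>_. ())" for V ident \<omega>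
    by (simp add: has_output_at_def fun_eq_iff state out)
  have node_output: "node_output A' V ident \<omega> = node_output A V ident (\<lambda>_. ())" for V ident \<omega>
    by (simp add: node_output_def fun_eq_iff has_output state out)
  have "rand_solves p P A'"
    unfolding rand_solves_def node_output
  proof (safe, goal_cases)
    case (1 V ident v)
    then show ?case
      by simp
  next
    case (2 V ident)
    have "correct_output P V (node_output A V ident (\<lambda>_. ()))"
      using A 2 unfolding det_solves_def by blast
    then show ?case
      using prob_space.prob_space[OF prob_space_random_bits] by simp
  qed
  moreover have "rand_time p P A' n \<le> det_time p P A n"
    unfolding rand_time_def det_time_def
    by (intro SUP_mono') (auto simp: rounds_def has_output intro!: SUP_least split: prod.split)
  ultimately show "rand_complexity p P n \<le> det_time p P A n"
    unfolding rand_complexity_def by (intro INF_lower2[of A']) auto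
qed

lemma rand_complexity_Omega:
  assumes P: "lcl_problem P" and p: "polynomial_id_range p"
    and no_labels: "labels (flexible_restriction P k) = {}"
  shows "complexity_Omega (arity P) (rand_complexity p P) (\<lambda>n. real n powr (1 / real (k + 2)))"
proof -
  let ?g = "\<lambda>n. real n powr (1 / real (k + 2))"
  define C where "C = 9 * (2 * k + 1) * (arity P + 1)"
  \<comment> \<open>The factor 2 absorbs the passage from \<open>m\<close> to \<open>m + 1\<close>:
    if \<open>m < c * ?g n\<close> and \<open>1 \<le> c * ?g n\<close>, then
    \<open>C * (m + 1) \<le> ?g n\<close>.\<close>
  define c where "c = 1 / (2 * real C)"
  have C: "C > 0"
    by (simp add: C_def)
  then have c: "c > 0"
    by (simp add: c_def)
  have "filterlim ?g at_top sequentially"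
    by real_asymp
  then have "\<forall>\<^sub>F n in sequentially. 1 / c \<le> ?g n"
    by (simp add: filterlim_at_top)
  moreover have "ereal (c * ?g n) \<le> ereal_of_enat (rand_complexity p P n)"
    if g: "1 / c \<le> ?g n" and n: "n \<in> tree_sizes (arity P)" for n
  proof (rule ccontr)
    assume "\<not> ereal (c * ?g n) \<le> ereal_of_enat (rand_complexity p P n)"
    \<comment> \<open>An infinite complexity satisfies the bound trivially. A finite value
      \<open>m\<close> yields an algorithm, possibly depending on \<open>n\<close>, whose time at
      \<open>n\<close> is below \<open>m + 1\<close>.\<close>
    then obtain m where m: "rand_complexity p P n = enat m" and less: "real m < c * ?g n"
      by (cases "rand_complexity p P n") auto
    have "rand_complexity p P n < enat (Suc m)"
      using m by simp
    then obtain A where A: "rand_solves p P A" "rand_time p P A n < enat (Suc m)"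
      unfolding rand_complexity_def INF_less_iff by blast
    have "n > 0"
      using g c by (cases "n = 0") (auto simp: field_simps)
    have "1 \<le> c * ?g n"
      using g c by (simp add: field_simps)
    then have "real C * (real m + 1) \<le> real C * (2 * (c * ?g n))"
      using less by (intro mult_left_mono) auto
    also have "\<dots> = ?g n"
      using C by (simp add: c_def)
    finally have "(real C * (real m + 1)) ^ (k + 2) \<le> ?g n ^ (k + 2)"
      by (intro power_mono) auto
    also have "\<dots> = real n powr (real (k + 2) * (1 / real (k + 2)))"
      using \<open>n > 0\<close> by (intro powr_power) simp
    also have "\<dots> = real n"
      using \<open>n > 0\<close> by simp
    finally have "real ((C * (m + 1)) ^ (k + 2)) \<le> real n"
      by (simp only: of_nat_mult of_nat_power of_nat_add of_nat_1)
    then have "(C * (m + 1)) ^ (k + 2) \<le> n"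
      unfolding of_nat_le_iff .
    then have "enat m < rand_time p P A n"
      unfolding C_def by (rule rand_time_lower_bound[OF P p A(1) no_labels n])
    then show False
      using A(2) by (cases "rand_time p P A n") auto
  qed
  ultimately have "\<forall>\<^sub>F n in sequentially. n \<in> tree_sizes (arity P) \<longrightarrow>
      ereal (c * ?g n) \<le> ereal_of_enat (rand_complexity p P n)"
    by (auto elim: eventually_mono)
  then show ?thesis
    unfolding complexity_Omega_def using c by blast
qed

theorem theorem5p2:
  fixes P :: "'l lcl" and p :: "nat \<Rightarrow> nat"
  assumes "lcl_problem P"
    and "polynomial_id_range p"
    and "\<not> has_log_certificate P"
  shows "\<exists>k::nat. k \<ge> 1 \<and>
           complexity_Omega (arity P) (rand_complexity p P) (\<lambda>n. real n powr (1 / real k)) \<and>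
           complexity_Omega (arity P) (det_complexity p P) (\<lambda>n. real n powr (1 / real k))"
proof -
  obtain k where "labels (flexible_restriction P k) = {}"
    using flexible_restriction_labels_empty[OF assms(1,3)] by blast
  then have "complexity_Omega (arity P) (rand_complexity p P) (\<lambda>n. real n powr (1 / real (k + 2)))"
    by (rule rand_complexity_Omega[OF assms(1,2)])
  moreover from this
  have "complexity_Omega (arity P) (det_complexity p P) (\<lambda>n. real n powr (1 / real (k + 2)))"
    by (rule complexity_Omega_mono) (rule rand_complexity_le_det_complexity[OF assms(1)])
  ultimately show ?thesis
    by (intro exI[of _ "k + 2"]) simp
qed

end
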